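(* Let $\mu\ge 0$ be a half integer, i.e. $\mu+\frac12\in\mathbb N$, and let $m\ge 0$ be an integer. Put $\phi_\nu=\frac{2\nu\pi}{2m+1}$ and $\psi_j=\frac{(2j+1)\pi}{4m+2}$ for $0\le \nu,j\le 2m$, and for $f\in C(B^2)$ define $$\mathcal A_{2m}^\mu(f;x,y)=\sum_{\nu=0}^{2m}\sum_{j=0}^{2m}\mathcal R_{\phi_\nu}^\mu(f;\cos\psi_j)\,T_{j,\nu}^\mu(x,y),\qquad T_{j,\nu}^\mu(x,y)=\frac{\mu+1/2}{(2m+1)^2}\,\sin\psi_j\;\Phi_{2m}^\mu(\phi_\nu,\cos\psi_j;x,y).$$ Then $\mathcal A_{2m}^\mu$ preserves polynomials of degree $2m-2\mu$; that is, $\mathcal A_{2m}^\mu P=P$ for every polynomial $P$ in two variables of total degree at most $2m-2\mu$.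
   Context: $B^2$ is the closed unit disk in $\mathbb R^2$; $W_\mu(x,y)=(1-x^2-y^2)^{\mu-1/2}$ on $B^2$; $a_\mu=(\mu+1/2)/\pi=1/\int_{B^2}W_\mu$; $\langle P,Q\rangle_\mu=a_\mu\int_{B^2}PQW_\mu\,dx\,dy$. $\mathcal V_k^2(W_\mu)$ is the space of polynomials in two variables of degree $k$ (together with $0$) that are orthogonal under $\langle\cdot,\cdot\rangle_\mu$ to all polynomials of total degree $<k$. Polynomials of negative degree are understood to be $0$. Attenuated Radon projection: $$\mathcal R_\theta^\mu(f;t)=\int_{-\sqrt{1-t^2}}^{\sqrt{1-t^2}}f(t\cos\theta-s\sin\theta,\,t\sin\theta+s\cos\theta)\,(1-s^2-t^2)^{\mu-1/2}\,ds .$$ $(a)_k=a(a+1)\cdots(a+k-1)$. $C_k^\lambda$ is the Gegenbauer polynomial of degree $k$, orthogonal for $(1-s^2)^{\lambda-1/2}$ on $[-1,1]$, with $C_k^\lambda(1)=(2\lambda)_k/k!$. $p_l^{(\alpha,\beta)}$ is the Jacobi polynomial of degree $l$ with positive leading coefficient, orthonormal for the weight $(1-t)^\alpha(1+t)^\beta$ normalized to have integral $1$ on $[-1,1]$. Orthonormal basis of $\mathcal V_k^2(W_\mu)$: in polar coordinates $x=r\cos\phi$, $y=r\sin\phi$, $$P_{l,\varepsilon}^k(x,y)=h_{l,k}\,p_l^{(\mu-1/2,\,k-2l)}(2r^2-1)\,r^{k-2l}S_{k-2l,\varepsilon}(\phi),$$ where $S_{j,0}(\phi)=\cos j\phi$,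 $S_{j,1}(\phi)=\sin j\phi$, $0\le 2l\le k$ if $\varepsilon=0$, $0\le 2l\le k-1$ if $\varepsilon=1$, and $$h_{l,k}^2=\frac1{d_{l,k}}\,\frac{\Gamma(k-2l+\mu+3/2)}{\Gamma(\mu+3/2)\Gamma(k-2l+1)},\quad h_{l,k}>0,\qquad d_{l,k}=\tfrac12\ (2l<k),\quad d_{l,k}=1\ (2l=k).$$ $$\lambda_{l,k}^\mu=\frac{l!\,(k-l)!\,(k-l+\mu+\frac12)}{(\mu+\frac12)_l\,(\mu+\frac32)_{k-l}\,(k+\mu+\frac12)},\qquad D_k^{\mu+1/2}(\xi;x,y)=\sum_{l,\varepsilon}\lambda_{l,k}^\mu\,P_{l,\varepsilon}^k(\cos\xi,\sin\xi)\,P_{l,\varepsilon}^k(x,y)$$ (sum over all admissible pairs $(l,\varepsilon)$), and $$\Phi_{2m}^\mu(\xi,t;x,y)=\sum_{k=0}^{2m}\frac{k+\mu+1/2}{\mu+1/2}\,C_k^{\mu+1/2}(t)\,D_k^{\mu+1/2}(\xi;x,y).$$ *)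

theory Defs
  imports "HOL-Analysis.Analysis" "HOL-Computational_Algebra.Polynomial"
begin

definition weighted_integral :: "(real \<Rightarrow> real) \<Rightarrow> real poly \<Rightarrow> real poly \<Rightarrow> real" where
  "weighted_integral w p q = integral {-1..1} (\<lambda>t. poly p t * poly q t * w t)"

definition jacobi_weight :: "real \<Rightarrow> real \<Rightarrow> real \<Rightarrow> real" where
  "jacobi_weight \<alpha> \<beta> t = (1 - t) powr \<alpha> * (1 + t) powr \<beta>"

text \<open>The descriptions below determine the whole sequence of polynomials; existence and
  uniqueness hold for \<open>lam > 0\<close> and for \<open>\<alpha>, \<beta> > -1\<close>, respectively.\<close>

definition gegenbauer :: "real \<Rightarrow> nat \<Rightarrow> real poly" where
  "gegenbauer lam = (THE C. \<forall>k.
     degree (C k) = k \<and>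
     poly (C k) 1 = pochhammer (2 * lam) k / fact k \<and>
     (\<forall>j. j \<noteq> k \<longrightarrow>
        weighted_integral (\<lambda>s. (1 - s\<^sup>2) powr (lam - 1/2)) (C k) (C j) = 0))"

definition jacobi_on :: "real \<Rightarrow> real \<Rightarrow> nat \<Rightarrow> real poly" where
  "jacobi_on \<alpha> \<beta> = (THE p. \<forall>k.
     degree (p k) = k \<and>
     lead_coeff (p k) > 0 \<and>
     (\<forall>j. weighted_integral (jacobi_weight \<alpha> \<beta>) (p k) (p j)
            / integral {-1..1} (jacobi_weight \<alpha> \<beta>) = (if j = k then 1 else 0)))"

definition radon_proj :: "real \<Rightarrow> real \<Rightarrow> (real \<times> real \<Rightarrow> real) \<Rightarrow> real \<Rightarrow> real" where
  "radon_proj \<mu> \<theta> f t =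
     integral {- sqrt (1 - t\<^sup>2) .. sqrt (1 - t\<^sup>2)}
       (\<lambda>s. f (t * cos \<theta> - s * sin \<theta>, t * sin \<theta> + s * cos \<theta>)
             * (1 - s\<^sup>2 - t\<^sup>2) powr (\<mu> - 1/2))"

text \<open>\<open>\<epsilon> = 0\<close> selects the cosine and \<open>\<epsilon> = 1\<close> the sine.\<close>

definition angular :: "nat \<Rightarrow> nat \<Rightarrow> real \<Rightarrow> real" where
  "angular j \<epsilon> \<phi> = (if \<epsilon> = 0 then cos (real j * \<phi>) else sin (real j * \<phi>))"

text \<open>The bound \<open>2l \<le> k - 1\<close> is written \<open>2l + 1 \<le> k\<close> to avoid truncated subtraction at \<open>k = 0\<close>.\<close>

definition basis_index :: "nat \<Rightarrow> (nat \<times> nat) set" where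
  "basis_index k = {(l, \<epsilon>). \<epsilon> = 0 \<and> 2 * l \<le> k \<or> \<epsilon> = 1 \<and> 2 * l + 1 \<le> k}"

definition d_const :: "nat \<Rightarrow> nat \<Rightarrow> real" where
  "d_const l k = (if 2 * l < k then 1/2 else 1)"

definition h_const :: "real \<Rightarrow> nat \<Rightarrow> nat \<Rightarrow> real" where
  "h_const \<mu> l k = sqrt (1 / d_const l k *
     (Gamma (real (k - 2 * l) + \<mu> + 3/2) / (Gamma (\<mu> + 3/2) * Gamma (real (k - 2 * l) + 1))))"

text \<open>The choice of polar angle at the origin is immaterial: there \<open>r ^ (k - 2l)\<close> vanishes
  unless \<open>k = 2l\<close>, in which case \<open>\<epsilon> = 0\<close> and the angular factor is constantly 1.\<close>

definition basis_poly :: "real \<Rightarrow> nat \<Rightarrow> nat \<Rightarrow> nat \<Rightarrow> real \<times> real \<Rightarrow> real" where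
  "basis_poly \<mu> k l \<epsilon> = (\<lambda>(x, y).
     let r = cmod (Complex x y); \<phi> = Arg (Complex x y) in
       h_const \<mu> l k * poly (jacobi_on (\<mu> - 1/2) (real (k - 2 * l)) l) (2 * r\<^sup>2 - 1)
         * r ^ (k - 2 * l) * angular (k - 2 * l) \<epsilon> \<phi>)"

definition lambda_const :: "real \<Rightarrow> nat \<Rightarrow> nat \<Rightarrow> real" where
  "lambda_const \<mu> l k =
     fact l * fact (k - l) * (real (k - l) + \<mu> + 1/2)
       / (pochhammer (\<mu> + 1/2) l * pochhammer (\<mu> + 3/2) (k - l) * (real k + \<mu> + 1/2))"

text \<open>\<open>D_kernel \<mu> k\<close> is \<open>D\<^sub>k\<close> with upper index \<open>\<mu> + 1/2\<close>.\<close>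

definition D_kernel :: "real \<Rightarrow> nat \<Rightarrow> real \<Rightarrow> real \<times> real \<Rightarrow> real" where
  "D_kernel \<mu> k \<xi> z =
     (\<Sum>(l, \<epsilon>)\<in>basis_index k.
        lambda_const \<mu> l k * basis_poly \<mu> k l \<epsilon> (cos \<xi>, sin \<xi>) * basis_poly \<mu> k l \<epsilon> z)"

definition Phi_kernel :: "real \<Rightarrow> nat \<Rightarrow> real \<Rightarrow> real \<Rightarrow> real \<times> real \<Rightarrow> real" where
  "Phi_kernel \<mu> n \<xi> t z =
     (\<Sum>k\<le>n. (real k + \<mu> + 1/2) / (\<mu> + 1/2)
              * poly (gegenbauer (\<mu> + 1/2) k) t * D_kernel \<mu> k \<xi> z)"

definition phi_node :: "nat \<Rightarrow> nat \<Rightarrow> real" where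
  "phi_node m \<nu> = 2 * real \<nu> * pi / (2 * real m + 1)"

definition psi_node :: "nat \<Rightarrow> nat \<Rightarrow> real" where
  "psi_node m j = (2 * real j + 1) * pi / (4 * real m + 2)"

definition T_fun :: "real \<Rightarrow> nat \<Rightarrow> nat \<Rightarrow> nat \<Rightarrow> real \<times> real \<Rightarrow> real" where
  "T_fun \<mu> m j \<nu> z =
     (\<mu> + 1/2) / (2 * real m + 1)\<^sup>2 * sin (psi_node m j)
       * Phi_kernel \<mu> (2 * m) (phi_node m \<nu>) (cos (psi_node m j)) z"

text \<open>\<open>A_op \<mu> m\<close> is the operator with subscript \<open>2m\<close>. It depends on \<open>f\<close> only through its
  restriction to the closed unit disk.\<close>

definition A_op :: "real \<Rightarrow> nat \<Rightarrow> (real \<times> real \<Rightarrow> real) \<Rightarrow> real \<times> real \<Rightarrow> real" where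
  "A_op \<mu> m f z =
     (\<Sum>\<nu>\<le>2 * m. \<Sum>j\<le>2 * m.
        radon_proj \<mu> (phi_node m \<nu>) f (cos (psi_node m j)) * T_fun \<mu> m j \<nu> z)"

text \<open>Polynomial functions of total degree at most \<open>d\<close>. The bound is a real number so that a
  negative one makes the sum empty and leaves only the zero polynomial.\<close>

definition polys2 :: "real \<Rightarrow> (real \<times> real \<Rightarrow> real) set" where
  "polys2 d = {P. \<exists>c :: nat \<Rightarrow> nat \<Rightarrow> real. \<forall>x y.
     P (x, y) = (\<Sum>(i, j)\<in>{(i, j). real (i + j) \<le> d}. c i j * x ^ i * y ^ j)}"

end

theory Submission
  imports Defs
begin

text \<open>
  Write \<open>\<mu> = n + 1/2\<close>. On a chord at distance \<open>cos \<psi>\<close> from the centre, the Radon projection of a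
  basis function \<open>F\<close> of degree \<open>k\<close> in direction \<open>\<theta>\<close> is \<open>sin\<^sup>2\<^sup>\<mu> \<psi>\<close> times a polynomial in
  \<open>cos \<psi>\<close>. Since \<open>F\<close> is orthogonal on the disk to all ridge polynomials of lower degree, this
  polynomial is a multiple of the Gegenbauer polynomial of degree \<open>k\<close>, and evaluation at \<open>\<psi> = 0\<close>
  gives the factor \<open>F(cos \<theta>, sin \<theta>)\<close> (Marr's formula). The sum over \<open>\<psi>\<^sub>j\<close> is a Gauss-Chebyshev
  quadrature; as \<open>2\<mu> + 1\<close> is even, the weight \<open>sin\<^sup>2\<^sup>\<mu>\<^sup>+\<^sup>1 \<psi>\<close> is a polynomial in \<open>cos \<psi>\<close>, and the bound
  \<open>k \<le> 2m - 2\<mu>\<close> makes the quadrature exact, so that only the summand of index \<open>k\<close> of the kernel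
  survives. The sum over \<open>\<phi>\<^sub>\<nu>\<close> is then a discrete Fourier orthogonality relation, which singles
  out the summand of \<open>F\<close> in \<open>D\<^sub>k\<close>, and \<open>\<lambda>\<close> is exactly the constant that normalizes it.
  All integrals over the disk are iterated integrals of monomials; their rotation invariance is
  verified infinitesimally on monomials.
\<close>

text \<open>Both families of orthogonal polynomials are given by definite descriptions, so each must
  first be identified with an explicit family. For Jacobi this is a hypergeometric sum, whose
  integrals are iterated finite differences. For Gegenbauer the chord integrals of Re z^k themselves
  serve as the family, so that Marr's formula and Gegenbauer orthogonality come out of one
  mechanism: multiplication by x shifts the frequency of a harmonic polynomial by one, a downward
  shift brings a factor x^2 + y^2, and a disk integral sees frequency 0 only. Since x is constant on
  the chords of direction 0, orthogonality to powers of x on the disk passes to the chord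
  polynomial. Half-integrality of \<mu> makes the exponent \<mu> - 1/2 = n of the disk weight a
  natural number, so that all moments obey elementary recurrences and all Gamma values are
  factorials. The Gegenbauer norm is traced back to the weighted area \<pi>/(n + 1) of the disk; it
  enters the quadrature as (2m + 1)/(k + n + 1), which is what the factor k + \<mu> + 1/2 of the
  kernel compensates.\<close>

section \<open>Orthogonal polynomials\<close>

text \<open>Subtracting a multiple of \<open>C k\<close> removes the top coefficient. An identity
  linear in \<open>p\<close> can thus be checked on whichever family with one member per degree
  suits it: Chebyshev polynomials for the quadrature, powers of 1 + t for Jacobi integrals, Jacobi
  polynomials for the reproduction property.\<close>

lemma poly_basis_induct [consumes 3, case_names zero add smult basis]:
  fixes C :: "nat \<Rightarrow> 'a::field poly"
  assumes deg: "\<And>k. degree (C k) = k" and nz: "\<And>k. C k \<noteq> 0" and p: "degree p \<le> d"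
    and zero: "Q 0" and add: "\<And>p q. Q p \<Longrightarrow> Q q \<Longrightarrow> Q (p + q)"
    and smult: "\<And>c p. Q p \<Longrightarrow> Q (smult c p)" and basis: "\<And>k. k \<le> d \<Longrightarrow> Q (C k)"
  shows "Q p"
proof -
  have "Q p" if "degree p = k" "k \<le> d" for k p
    using that
  proof (induction k arbitrary: p rule: less_induct)
    case (less k)
    define a where "a = lead_coeff p / lead_coeff (C k)"
    define r where "r = p - smult a (C k)"
    have lc: "lead_coeff (C k) \<noteq> 0" using nz by simp
    have ck: "coeff r k = 0"
      using lc less.prems(1) by (simp add: r_def a_def deg)
    have "degree r \<le> k"
      unfolding r_def using less.prems(1)
      by (intro degree_diff_le) (auto intro: order.trans[OF degree_smult_le] simp: deg)
    have "Q r"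
    proof (cases "r = 0")
      case True
      then show ?thesis by (simp add: zero)
    next
      case False
      have "degree r < k"
        using ck False \<open>degree r \<le> k\<close> by (metis le_neq_implies_less leading_coeff_0_iff)
      then show ?thesis using less.IH[of "degree r" r] less.prems(2) by simp
    qed
    then have "Q (r + smult a (C k))"
      using add smult basis less.prems(2) by blast
    then show ?case by (simp add: r_def)
  qed
  then show ?thesis using p by blast
qed

text \<open>Abstracts integration of a polynomial against a weight, so that orthogonality arguments
  run on \<open>\<phi>\<close> alone, free of integrability side conditions. It serves both the
  Gegenbauer and the Jacobi weight.\<close>

locale positive_functional =
  fixes \<phi> :: "real poly \<Rightarrow> real"
  assumes add: "\<phi> (p + q) = \<phi> p + \<phi> q"
    and smult: "\<phi> (smult c p) = c * \<phi> p"
    and pos: "p \<noteq> 0 \<Longrightarrow> \<phi> (p * p) > 0"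
begin

lemma zero: "\<phi> 0 = 0"
  using smult[of 0 0] by simp

lemma diff: "\<phi> (p - q) = \<phi> p - \<phi> q"
  using add[of "p - q" q] by simp

lemma eq_0_iff: "\<phi> (p * p) = 0 \<longleftrightarrow> p = 0"
  using pos[of p] zero by (cases "p = 0") auto

definition orthogonal_seq :: "(nat \<Rightarrow> real poly) \<Rightarrow> bool" where
  "orthogonal_seq C \<longleftrightarrow> (\<forall>k. degree (C k) = k \<and> C k \<noteq> 0 \<and> (\<forall>j. j \<noteq> k \<longrightarrow> \<phi> (C k * C j) = 0))"

lemma orthogonal_seq_lower:
  assumes C: "orthogonal_seq C" and p: "degree p < k"
  shows "\<phi> (C k * p) = 0"
proof -
  have deg: "\<And>j. degree (C j) = j" and nz: "\<And>j. C j \<noteq> 0"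
    and orth: "\<And>j. j \<noteq> k \<Longrightarrow> \<phi> (C k * C j) = 0"
    using C by (auto simp: orthogonal_seq_def)
  have "degree p \<le> k - 1" using p by simp
  from deg nz this show ?thesis
  proof (induction p rule: poly_basis_induct)
    case (basis j)
    then show ?case using p orth by simp
  qed (simp_all add: zero add smult distrib_left)
qed

text \<open>Once the top coefficients cancel, the remainder has degree below \<open>k\<close>, hence
  is orthogonal to \<open>q\<close> and to \<open>C k\<close>, hence to itself. This is how a chord
  integral is recognized as a Gegenbauer polynomial up to a scalar.\<close>

lemma orthogonal_seq_multiple:
  assumes C: "orthogonal_seq C" and q: "degree q \<le> k"
    and orth: "\<And>p. degree p < k \<Longrightarrow> \<phi> (q * p) = 0"
  obtains c where "q = Polynomial.smult c (C k)"
proof -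
  define c where "c = coeff q k / coeff (C k) k"
  define r where "r = q - Polynomial.smult c (C k)"
  have Ck: "degree (C k) = k" "coeff (C k) k \<noteq> 0"
    using C unfolding orthogonal_seq_def by (metis leading_coeff_0_iff)+
  have "coeff r k = 0" using Ck by (simp add: r_def c_def)
  moreover have "degree r \<le> k"
    unfolding r_def using q Ck
    by (intro degree_diff_le) (auto intro: order.trans[OF degree_smult_le])
  ultimately have "r = 0 \<or> degree r < k"
    by (metis le_neq_implies_less leading_coeff_0_iff)
  then have "r = 0"
  proof
    assume r: "degree r < k"
    have "\<phi> (r * r) = \<phi> (q * r) - c * \<phi> (C k * r)"
      by (subst (1) r_def) (simp add: algebra_simps diff smult)
    then show "r = 0"
      using orth[OF r] orthogonal_seq_lower[OF C r] eq_0_iff by simp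
  qed simp
  then show ?thesis using that[of c] by (simp add: r_def)
qed

lemma orthogonal_seq_unique:
  assumes "orthogonal_seq C" "orthogonal_seq C'"
  obtains c where "C' k = Polynomial.smult c (C k)"
proof (rule orthogonal_seq_multiple[OF assms(1)])
  show "degree (C' k) \<le> k" using assms(2) by (simp add: orthogonal_seq_def)
  show "\<phi> (C' k * p) = 0" if "degree p < k" for p
    using orthogonal_seq_lower[OF assms(2) that] .
qed

lemma orthogonal_seqI_lower:
  assumes "\<And>k. degree (C k) = k" "\<And>k. C k \<noteq> 0"
    and "\<And>k p. degree p < k \<Longrightarrow> \<phi> (C k * p) = 0"
  shows "orthogonal_seq C"
  unfolding orthogonal_seq_def
proof (intro allI conjI impI)
  fix k j :: nat assume "j \<noteq> k"
  then consider "j < k" | "k < j" by linarith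
  then show "\<phi> (C k * C j) = 0"
    by cases (use assms(3)[of "C j" k] assms(3)[of "C k" j] assms(1) in \<open>auto simp: mult.commute\<close>)
qed (use assms in auto)

end

section \<open>Identifying the sequences given by definite descriptions\<close>

lemma gegenbauer_eqI:
  assumes "positive_functional \<phi>"
    and wi: "\<And>p q. weighted_integral (\<lambda>s. (1 - s\<^sup>2) powr (lam - 1/2)) p q = \<phi> (p * q)"
    and lam: "lam > 0"
    and C: "positive_functional.orthogonal_seq \<phi> C"
    and C1: "\<And>k. poly (C k) 1 = pochhammer (2 * lam) k / fact k"
  shows "gegenbauer lam = C"
proof -
  interpret positive_functional \<phi> by fact
  show ?thesis
    unfolding gegenbauer_def wi
  proof (rule the_equality)
    show "\<forall>k. degree (C k) = k \<and> poly (C k) 1 = pochhammer (2 * lam) k / fact k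
            \<and> (\<forall>j. j \<noteq> k \<longrightarrow> \<phi> (C k * C j) = 0)"
      using C C1 by (simp add: orthogonal_seq_def)
  next
    fix C' assume C': "\<forall>k. degree (C' k) = k \<and> poly (C' k) 1 = pochhammer (2 * lam) k / fact k
            \<and> (\<forall>j. j \<noteq> k \<longrightarrow> \<phi> (C' k * C' j) = 0)"
    have pos: "pochhammer (2 * lam) k / fact k > 0" for k
      using lam by (simp add: pochhammer_pos)
    \<comment> \<open>\<open>degree (C' k) = k\<close> would allow the zero polynomial at
      \<open>k = 0\<close>; the nonzero value at 1 excludes it.\<close>
    have "C' k \<noteq> 0" for k
      using C' pos[of k] by (metis less_irrefl poly_0)
    with C' have "orthogonal_seq C'" by (simp add: orthogonal_seq_def)
    show "C' = C"
    proof
      fix k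
      obtain c where c: "C' k = Polynomial.smult c (C k)"
        using orthogonal_seq_unique[OF C \<open>orthogonal_seq C'\<close>] .
      then have "poly (C' k) 1 = c * poly (C k) 1" by simp
      then have "c = 1" using C' C1[of k] pos[of k] by (metis less_irrefl mult_cancel_right1)
      then show "C' k = C k" using c by simp
    qed
  qed
qed

lemma jacobi_on_eqI:
  assumes "positive_functional \<phi>"
    and wi: "\<And>p q. weighted_integral (jacobi_weight \<alpha> \<beta>) p q / integral {-1..1} (jacobi_weight \<alpha> \<beta>) = \<phi> (p * q)"
    and C: "positive_functional.orthogonal_seq \<phi> C"
    and C1: "\<And>k. \<phi> (C k * C k) = 1" and lc: "\<And>k. lead_coeff (C k) > 0"
  shows "jacobi_on \<alpha> \<beta> = C"
proof -
  interpret positive_functional \<phi> by fact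
  show ?thesis
    unfolding jacobi_on_def wi
  proof (rule the_equality)
    show "\<forall>k. degree (C k) = k \<and> lead_coeff (C k) > 0
            \<and> (\<forall>j. \<phi> (C k * C j) = (if j = k then 1 else 0))"
      using C C1 lc by (simp add: orthogonal_seq_def)
  next
    fix C' assume C': "\<forall>k. degree (C' k) = k \<and> lead_coeff (C' k) > 0
            \<and> (\<forall>j. \<phi> (C' k * C' j) = (if j = k then 1 else 0))"
    have "C' k \<noteq> 0" for k
      using C' by (metis leading_coeff_0_iff less_irrefl)
    with C' have "orthogonal_seq C'" by (simp add: orthogonal_seq_def)
    show "C' = C"
    proof
      fix k
      obtain c where c: "C' k = Polynomial.smult c (C k)"
        using orthogonal_seq_unique[OF C \<open>orthogonal_seq C'\<close>] .
      then have "\<phi> (C' k * C' k) = c * c * \<phi> (C k * C k)" by (simp add: smult)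
      \<comment> \<open>Unit norm leaves the sign of \<open>c\<close> open; the leading coefficient
        decides it.\<close>
      then have "c * c = 1" using C' C1[of k] by simp
      moreover have "lead_coeff (C' k) = c * lead_coeff (C k)" using c by simp
      then have "c > 0" using C' lc[of k] by (metis zero_less_mult_pos2)
      ultimately have "c = 1" by (metis less_asym' mult_cancel_left1 mult_less_cancel_left_pos linorder_neqE_linordered_idom one_less_mult zero_less_one mult.right_neutral less_trans)
      then show "C' k = C k" using c by simp
    qed
  qed
qed

section \<open>The Gegenbauer weight in trigonometric form\<close>

lemma square_powr_half:
  fixes x :: real
  assumes "x \<ge> 0"
  shows "x\<^sup>2 powr (real n + 1/2) = x ^ (2 * n + 1)"
proof (cases "x = 0")
  case False
  then have x: "x > 0" using assms by simp
  then have "x\<^sup>2 powr (real n + 1/2) = x powr (2 * (real n + 1/2))"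
    by (simp add: powr_powr flip: powr_numeral)
  also have "2 * (real n + 1/2) = real (2 * n + 1)" by simp
  finally show ?thesis using x by (simp only: powr_realpow)
qed simp

text \<open>The Gegenbauer integral of index n + 1 after s = cos \<psi>: the weight (1 - s^2)^(n +
  1/2) becomes sin^(2n + 1), and ds contributes one more sine.\<close>

definition gegen_int :: "nat \<Rightarrow> real poly \<Rightarrow> real" where
  "gegen_int n p = integral {0..pi} (\<lambda>\<psi>. poly p (cos \<psi>) * sin \<psi> ^ (2 * n + 2))"

lemma gegen_int_eq_weighted:
  "integral {-1..1} (\<lambda>s. poly p s * (1 - s\<^sup>2) powr (real n + 1/2)) = gegen_int n p"
proof -
  let ?f = "\<lambda>s. poly p s * (1 - s\<^sup>2) powr (real n + 1/2)"
  have cont: "continuous_on {-1..1} ?f"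
    by (intro continuous_intros continuous_on_powr')
       (auto simp: abs_square_le_1 simp flip: abs_le_iff)
  \<comment> \<open>\<open>cos\<close> decreases, so the interval {cos 0..cos pi} is empty; the
    remaining sign is removed by the negation that follows.\<close>
  have "((\<lambda>x. (- sin x) *\<^sub>R ?f (cos x)) has_integral
          (integral {cos 0..cos pi} ?f - integral {cos pi..cos 0} ?f)) {0..pi}"
    by (rule has_integral_substitution_general[of "{}" 0 pi cos "-1" 1])
       (auto intro!: continuous_intros derivative_eq_intros cont)
  then have "((\<lambda>x. - (- sin x) *\<^sub>R ?f (cos x)) has_integral integral {-1..1} ?f) {0..pi}"
    by (drule_tac has_integral_neg) simp
  then have "((\<lambda>\<psi>. poly p (cos \<psi>) * sin \<psi> ^ (2 * n + 2)) has_integral integral {-1..1} ?f) {0..pi}"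
  proof (rule has_integral_eq[rotated])
    fix x assume "x \<in> {0..pi}"
    then have "(1 - (cos x)\<^sup>2) powr (real n + 1/2) = sin x ^ (2 * n + 1)"
      using square_powr_half[of "sin x" n] sin_ge_zero[of x] by (simp add: sin_squared_eq)
    then show "- (- sin x) *\<^sub>R ?f (cos x) = poly p (cos x) * sin x ^ (2 * n + 2)"
      by simp
  qed
  then show ?thesis by (simp add: gegen_int_def integral_unique)
qed

lemma gegen_int_integrable:
  "(\<lambda>\<psi>. poly p (cos \<psi>) * sin \<psi> ^ (2 * n + 2)) integrable_on {0..pi}"
  by (intro integrable_continuous_real continuous_intros)

lemma poly_eq_0_interval:
  fixes p :: "real poly"
  assumes "a < b" "\<And>t. a < t \<Longrightarrow> t < b \<Longrightarrow> poly p t = 0"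
  shows "p = 0"
proof (rule ccontr)
  assume "p \<noteq> 0"
  then have "finite {t. poly p t = 0}" by (rule poly_roots_finite)
  moreover have "{a<..<b} \<subseteq> {t. poly p t = 0}" using assms by auto
  ultimately show False using assms(1) infinite_Ioo finite_subset by blast
qed

lemma positive_functional_gegen_int: "positive_functional (gegen_int n)"
proof
  fix p q :: "real poly" and c :: real
  show "gegen_int n (p + q) = gegen_int n p + gegen_int n q"
    unfolding gegen_int_def
    by (subst integral_add[symmetric]) (use gegen_int_integrable in \<open>auto simp: distrib_right\<close>)
  show "gegen_int n (Polynomial.smult c p) = c * gegen_int n p"
    unfolding gegen_int_def by (simp add: mult.assoc)
  assume "p \<noteq> 0"
  let ?f = "\<lambda>\<psi>. poly (p * p) (cos \<psi>) * sin \<psi> ^ (2 * n + 2)"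
  have nonneg: "?f x \<ge> 0" if "x \<in> {0..pi}" for x
    using that sin_ge_zero[of x] by simp
  have "gegen_int n (p * p) \<ge> 0"
    unfolding gegen_int_def using nonneg by (rule integral_nonneg[OF gegen_int_integrable])
  moreover have "gegen_int n (p * p) \<noteq> 0"
  proof
    assume "gegen_int n (p * p) = 0"
    moreover have "continuous_on {0..pi} ?f" by (intro continuous_intros)
    ultimately have 0: "\<forall>x\<in>{0..pi}. ?f x = 0"
      using integral_eq_0_iff[where f = ?f, OF _ pi_gt_zero nonneg] unfolding gegen_int_def by blast
    have "p = 0"
    proof (rule poly_eq_0_interval[of "-1" 1])
      fix t :: real assume t: "-1 < t" "t < 1"
      then have "arccos t \<in> {0..pi}" "cos (arccos t) = t" "sin (arccos t) > 0"
        using arccos_lt_bounded[of t] by (auto intro!: sin_gt_zero arccos_lbound arccos_ubound)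
      with 0 show "poly p t = 0" by (metis mult_eq_0_iff poly_mult power_not_zero less_irrefl)
    qed simp
    with \<open>p \<noteq> 0\<close> show False by simp
  qed
  ultimately show "gegen_int n (p * p) > 0" by simp
qed

section \<open>Discrete orthogonality at the nodes\<close>

fun cheb_poly :: "nat \<Rightarrow> real poly" where
  "cheb_poly 0 = 1"
| "cheb_poly (Suc 0) = [:0, 1:]"
| "cheb_poly (Suc (Suc k)) = [:0, 2:] * cheb_poly (Suc k) - cheb_poly k"

lemma degree_cheb_poly: "degree (cheb_poly k) = k \<and> cheb_poly k \<noteq> 0"
proof (induction k rule: cheb_poly.induct)
  case (3 k)
  then have 1: "degree ([:0, 2:] * cheb_poly (Suc k)) = Suc (Suc k)"
    by (subst degree_mult_eq) auto
  then have "degree ([:0, 2:] * cheb_poly (Suc k) + - cheb_poly k) = Suc (Suc k)"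
    by (subst degree_add_eq_left) (use 3 in auto)
  then show ?case by (metis cheb_poly.simps(3) degree_0 nat.distinct(1) uminus_add_conv_diff add.commute)
qed auto

lemma poly_cheb_poly_cos: "poly (cheb_poly k) (cos x) = cos (real k * x)"
proof (induction k rule: cheb_poly.induct)
  case (3 k)
  have "cos (real (Suc (Suc k)) * x) + cos (real k * x) = 2 * cos x * cos (real (Suc k) * x)"
    using cos_plus_cos[of "real (Suc (Suc k)) * x" "real k * x"]
    by (simp add: field_simps add_divide_distrib)
  then show ?case using 3 by simp
qed auto

lemma integral_cos_multiple:
  "integral {0..pi} (\<lambda>x. cos (real k * x)) = (if k = 0 then pi else 0)"
proof (cases "k = 0")
  case False
  have "((\<lambda>x. cos (real k * x)) has_integral sin (real k * pi) / real k - sin (real k * 0) / real k) {0..pi}"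
    using False
    by (intro fundamental_theorem_of_calculus)
       (auto intro!: derivative_eq_intros simp flip: has_real_derivative_iff_has_vector_derivative)
  then show ?thesis using False by (simp add: integral_unique)
qed simp

text \<open>The factor 2 sin \<open>h\<close>, where \<open>h\<close> is half the step between
  consecutive angles, telescopes the sum to sin (k \<pi>) = 0. The bound on \<open>k\<close> keeps
  \<open>h\<close> below \<pi>, so that sin \<open>h\<close> can be cancelled.\<close>

lemma sum_cos_psi_node:
  assumes "k \<le> 4 * m + 1"
  shows "(\<Sum>j\<le>2 * m. cos (real k * psi_node m j)) = (if k = 0 then 2 * real m + 1 else 0)"
proof (cases "k = 0")
  case False
  define h where "h = real k * pi / (4 * real m + 2)"
  have "real k / (4 * real m + 2) < 1" using assms by (simp add: divide_less_eq)
  then have "real k / (4 * real m + 2) * pi < 1 * pi" by (rule mult_strict_right_mono) simp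
  then have "h > 0" "h < pi" using False by (simp_all add: h_def)
  then have h: "sin h > 0" by (rule sin_gt_zero)
  have "2 * sin h * (\<Sum>j\<le>J. cos (real k * psi_node m j)) = sin (real (2 * Suc J) * h)" for J
  proof (induction J)
    case 0
    then show ?case using sin_double[of h] by (simp add: h_def psi_node_def mult_ac)
  next
    case (Suc J)
    have e: "real k * psi_node m (Suc J) = (2 * real J + 3) * h"
      by (simp add: h_def psi_node_def field_simps)
    have "sin (real (2 * Suc (Suc J)) * h) - sin (real (2 * Suc J) * h)
        = 2 * sin h * cos ((2 * real J + 3) * h)"
      using sin_diff_sin[of "real (2 * Suc (Suc J)) * h" "real (2 * Suc J) * h"]
      by (simp add: algebra_simps add_divide_distrib)
    with Suc show ?case by (simp add: e distrib_left)
  qed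
  from this[of "2 * m"]
  have "2 * sin h * (\<Sum>j\<le>2 * m. cos (real k * psi_node m j)) = sin (real (2 * Suc (2 * m)) * h)" .
  also have "real (2 * Suc (2 * m)) * h = real k * pi" by (simp add: h_def field_simps)
  finally show ?thesis using h False by simp
qed simp

text \<open>The points cos \<psi>_j are the zeros of the Chebyshev polynomial of degree 2m + 1, so
  4m + 1 = 2 (2m + 1) - 1 is the Gauss degree of exactness. For k > 0 both sides vanish on
  \<open>cheb_poly k\<close>.\<close>

lemma chebyshev_quadrature:
  assumes "degree p \<le> 4 * m + 1"
  shows "(\<Sum>j\<le>2 * m. poly p (cos (psi_node m j))) / (2 * real m + 1)
    = integral {0..pi} (\<lambda>\<psi>. poly p (cos \<psi>)) / pi"
proof -
  have int: "(\<lambda>\<psi>. poly p (cos \<psi>)) integrable_on {0..pi}" for p :: "real poly"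
    by (intro integrable_continuous_real continuous_intros)
  have deg: "\<And>k. degree (cheb_poly k) = k" and nz: "\<And>k. cheb_poly k \<noteq> 0"
    using degree_cheb_poly by auto
  from deg nz assms show ?thesis
  proof (induction p rule: poly_basis_induct)
    case (add p q)
    then show ?case
      by (simp add: sum.distrib add_divide_distrib integral_add int)
  next
    case (smult c p)
    then show ?case by (simp flip: sum_distrib_left times_divide_eq_right)
  next
    case (basis k)
    then show ?case
      by (simp add: poly_cheb_poly_cos sum_cos_psi_node integral_cos_multiple)
  qed simp
qed

text \<open>A zero would make \<open>e\<close> a multiple of the odd number 2m + 1; as
  \<open>e\<close> is even, the cofactor is even too, which pushes the absolute value of
  \<open>e\<close> to at least 4m + 2.\<close>

lemma sin_phi_node_nonzero:
  fixes e :: int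
  assumes "even e" "e \<noteq> 0" "\<bar>e\<bar> \<le> 4 * int m"
  shows "sin (of_int e * pi / (2 * real m + 1)) \<noteq> 0"
proof
  assume "sin (of_int e * pi / (2 * real m + 1)) = 0"
  then obtain i :: int where "of_int e * pi / (2 * real m + 1) = of_int i * pi"
    using sin_zero_iff_int2 by blast
  then have "of_int e * pi = of_int i * (2 * real m + 1) * pi" by (simp add: field_simps)
  then have "of_int e = (of_int i * (2 * real m + 1) :: real)" by simp
  then have e: "e = i * (2 * int m + 1)"
    by (metis (mono_tags, opaque_lifting) of_int_eq_iff of_int_mult of_int_add of_int_1 of_int_numeral of_int_of_nat_eq)
  then have "even i" using assms(1) by simp
  then obtain i' where i': "i = 2 * i'" by blast
  then have "\<bar>i'\<bar> \<ge> 1" using assms(2) e by auto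
  then have "1 * (4 * int m + 2) \<le> \<bar>i'\<bar> * (4 * int m + 2)"
    by (intro mult_right_mono) auto
  also have "\<dots> = \<bar>e\<bar>" using e i' by (simp add: abs_mult)
  finally show False using assms(3) by simp
qed

lemma sum_cos_sin_phi_node:
  fixes e :: int
  assumes "even e" "\<bar>e\<bar> \<le> 4 * int m"
  shows "(\<Sum>\<nu>\<le>2 * m. cos (of_int e * phi_node m \<nu>)) = (if e = 0 then 2 * real m + 1 else 0)"
    and "(\<Sum>\<nu>\<le>2 * m. sin (of_int e * phi_node m \<nu>)) = 0"
proof -
  define h where "h = of_int e * pi / (2 * real m + 1)"
  have e: "of_int e * phi_node m \<nu> = 2 * real \<nu> * h" for \<nu>
    by (simp add: h_def phi_node_def)
  \<comment> \<open>Modulo 2\<pi> the upper end of the telescoping sums is - \<open>h\<close>, so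
    the boundary terms cancel.\<close>
  have last: "(2 * real (2 * m) + 1) * h = 2 * pi * of_int e - h"
    by (simp add: h_def field_simps)
  have c: "2 * sin h * (\<Sum>\<nu>\<le>J. cos (2 * real \<nu> * h)) = sin ((2 * real J + 1) * h) + sin h" for J
  proof (induction J)
    case (Suc J)
    have "sin ((2 * real (Suc J) + 1) * h) - sin ((2 * real J + 1) * h)
        = 2 * sin h * cos (2 * real (Suc J) * h)"
      using sin_diff_sin[of "(2 * real (Suc J) + 1) * h" "(2 * real J + 1) * h"]
      by (simp add: algebra_simps add_divide_distrib)
    with Suc show ?case by (simp add: distrib_left)
  qed simp
  have s: "2 * sin h * (\<Sum>\<nu>\<le>J. sin (2 * real \<nu> * h)) = cos h - cos ((2 * real J + 1) * h)" for J
  proof (induction J)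
    case (Suc J)
    have "cos ((2 * real J + 1) * h) - cos ((2 * real (Suc J) + 1) * h)
        = 2 * sin h * sin (2 * real (Suc J) * h)"
      using cos_diff_cos[of "(2 * real J + 1) * h" "(2 * real (Suc J) + 1) * h"]
      by (simp add: algebra_simps add_divide_distrib)
    with Suc show ?case by (simp add: distrib_left)
  qed simp
  have nz: "sin h \<noteq> 0" if "e \<noteq> 0"
    using sin_phi_node_nonzero[OF assms(1) that assms(2)] by (simp add: h_def)
  show "(\<Sum>\<nu>\<le>2 * m. cos (of_int e * phi_node m \<nu>)) = (if e = 0 then 2 * real m + 1 else 0)"
  proof (cases "e = 0")
    case False
    have "sin (2 * pi * of_int e - h) = - sin h"
      using sin_cos_eq_iff by (simp add: sin_diff)
    then have "2 * sin h * (\<Sum>\<nu>\<le>2 * m. cos (2 * real \<nu> * h)) = 0"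
      using c[of "2 * m"] unfolding last by simp
    then show ?thesis using nz False by (simp add: e)
  qed simp
  show "(\<Sum>\<nu>\<le>2 * m. sin (of_int e * phi_node m \<nu>)) = 0"
  proof (cases "e = 0")
    case False
    have "cos (2 * pi * of_int e - h) = cos h"
      by (simp add: cos_diff)
    then have "2 * sin h * (\<Sum>\<nu>\<le>2 * m. sin (2 * real \<nu> * h)) = 0"
      using s[of "2 * m"] unfolding last by simp
    then show ?thesis using nz False by (simp add: e)
  qed simp
qed

text \<open>Frequencies of equal parity up to \<open>2 m\<close> combine to even frequencies up to \<open>4 m\<close>, and the
  odd number \<open>2 m + 1\<close> of nodes divides none of these except 0.\<close>

lemma sum_angular_phi_node:
  assumes "j \<le> 2 * m" "j' \<le> 2 * m" "even (j + j')" "\<epsilon> \<le> 1" "\<epsilon>' \<le> 1"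
    and "\<epsilon> = 1 \<Longrightarrow> j > 0" "\<epsilon>' = 1 \<Longrightarrow> j' > 0"
  shows "(\<Sum>\<nu>\<le>2 * m. angular j \<epsilon> (phi_node m \<nu>) * angular j' \<epsilon>' (phi_node m \<nu>))
    = (if j = j' \<and> \<epsilon> = \<epsilon>' then (2 * real m + 1) * (if j = 0 then 1 else 1/2) else 0)"
proof -
  let ?d = "int j - int j'" and ?s = "int j + int j'"
  note sums = sum_cos_sin_phi_node[of ?d m] sum_cos_sin_phi_node[of ?s m]
  have d: "even ?d" "\<bar>?d\<bar> \<le> 4 * int m" "even ?s" "\<bar>?s\<bar> \<le> 4 * int m"
    using assms by auto
  have e: "of_int ?d * x = real j * x - real j' * x" "of_int ?s * x = real j * x + real j' * x" for x :: real
    by (simp_all add: algebra_simps)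
  note sums = sums(1)[OF d(1,2)] sums(2)[OF d(1,2)] sums(3)[OF d(3,4)] sums(4)[OF d(3,4)]
  have "\<epsilon> = 0 \<or> \<epsilon> = 1" "\<epsilon>' = 0 \<or> \<epsilon>' = 1" using assms by auto
  then consider "\<epsilon> = 0" "\<epsilon>' = 0" | "\<epsilon> = 1" "\<epsilon>' = 1" | "\<epsilon> = 0" "\<epsilon>' = 1" | "\<epsilon> = 1" "\<epsilon>' = 0"
    by auto
  then show ?thesis
  proof cases
    case 1
    have "(\<Sum>\<nu>\<le>2 * m. angular j \<epsilon> (phi_node m \<nu>) * angular j' \<epsilon>' (phi_node m \<nu>))
      = ((\<Sum>\<nu>\<le>2 * m. cos (of_int ?d * phi_node m \<nu>)) + (\<Sum>\<nu>\<le>2 * m. cos (of_int ?s * phi_node m \<nu>))) / 2"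
      unfolding e using 1
      by (simp add: angular_def cos_times_cos sum_divide_distrib flip: sum.distrib)
    then show ?thesis unfolding sums using 1 by auto
  next
    case 2
    have "(\<Sum>\<nu>\<le>2 * m. angular j \<epsilon> (phi_node m \<nu>) * angular j' \<epsilon>' (phi_node m \<nu>))
      = ((\<Sum>\<nu>\<le>2 * m. cos (of_int ?d * phi_node m \<nu>)) - (\<Sum>\<nu>\<le>2 * m. cos (of_int ?s * phi_node m \<nu>))) / 2"
      unfolding e using 2
      by (simp add: angular_def sin_times_sin sum_divide_distrib flip: sum_subtractf)
    then show ?thesis unfolding sums using 2 assms by auto
  next
    case 3
    have "(\<Sum>\<nu>\<le>2 * m. angular j \<epsilon> (phi_node m \<nu>) * angular j' \<epsilon>' (phi_node m \<nu>))
      = ((\<Sum>\<nu>\<le>2 * m. sin (of_int ?s * phi_node m \<nu>)) - (\<Sum>\<nu>\<le>2 * m. sin (of_int ?d * phi_node m \<nu>))) / 2"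
      unfolding e using 3
      by (simp add: angular_def cos_times_sin sum_divide_distrib flip: sum_subtractf)
    then show ?thesis unfolding sums using 3 by auto
  next
    case 4
    have "(\<Sum>\<nu>\<le>2 * m. angular j \<epsilon> (phi_node m \<nu>) * angular j' \<epsilon>' (phi_node m \<nu>))
      = ((\<Sum>\<nu>\<le>2 * m. sin (of_int ?s * phi_node m \<nu>)) + (\<Sum>\<nu>\<le>2 * m. sin (of_int ?d * phi_node m \<nu>))) / 2"
      unfolding e using 4
      by (simp add: angular_def sin_times_cos sum_divide_distrib flip: sum.distrib)
    then show ?thesis unfolding sums using 4 by auto
  qed
qed

section \<open>Jacobi polynomials with integer parameters\<close>

text \<open>By Pascal's rule. Such sums are l-th finite differences, and this is the induction step
  for evaluating them.\<close>

lemma sum_alternating_binomial_Suc: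
  fixes f :: "nat \<Rightarrow> real"
  shows "(\<Sum>i\<le>Suc l. (-1) ^ i * real (Suc l choose i) * f i)
    = (\<Sum>i\<le>l. (-1) ^ i * real (l choose i) * (f i - f (Suc i)))"
proof -
  have "(\<Sum>i\<le>Suc l. (-1) ^ i * real (Suc l choose i) * f i)
      = f 0 + (\<Sum>i\<le>l. (-1) ^ Suc i * real (Suc l choose Suc i) * f (Suc i))"
    by (subst sum.atMost_Suc_shift) simp
  also have "(\<Sum>i\<le>l. (-1) ^ Suc i * real (Suc l choose Suc i) * f (Suc i))
      = (\<Sum>i\<le>l. (-1) ^ Suc i * real (l choose Suc i) * f (Suc i))
        - (\<Sum>i\<le>l. (-1) ^ i * real (l choose i) * f (Suc i))"
    unfolding sum_subtractf[symmetric] by (intro sum.cong) (simp_all add: algebra_simps)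
  also have "f 0 + ((\<Sum>i\<le>l. (-1) ^ Suc i * real (l choose Suc i) * f (Suc i))
        - (\<Sum>i\<le>l. (-1) ^ i * real (l choose i) * f (Suc i)))
      = (\<Sum>i\<le>Suc l. (-1) ^ i * real (l choose i) * f i)
        - (\<Sum>i\<le>l. (-1) ^ i * real (l choose i) * f (Suc i))"
    by (subst sum.atMost_Suc_shift) simp
  also have "\<dots> = (\<Sum>i\<le>l. (-1) ^ i * real (l choose i) * (f i - f (Suc i)))"
    by (simp add: algebra_simps sum_subtractf)
  finally show ?thesis .
qed

text \<open>An l-th difference kills polynomials of degree below l. Rising factorials suit the
  induction because differencing shortens them by one factor and shifts their argument.\<close>

lemma sum_alternating_pochhammer:
  fixes x :: real
  assumes "r < l"
  shows "(\<Sum>i\<le>l. (-1) ^ i * real (l choose i) * pochhammer (real i + x) r) = 0"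
  using assms
proof (induction l arbitrary: r x)
  case (Suc l)
  show ?case
  proof (cases r)
    case 0
    then show ?thesis unfolding sum_alternating_binomial_Suc by simp
  next
    case (Suc r')
    have "pochhammer (real i + x) r - pochhammer (real (Suc i) + x) r
        = - real r * pochhammer (real i + (x + 1)) r'" for i
      unfolding Suc by (subst pochhammer_rec, subst pochhammer_rec') (simp add: algebra_simps)
    then have "(\<Sum>i\<le>Suc l. (-1) ^ i * real (Suc l choose i) * pochhammer (real i + x) r)
        = - real r * (\<Sum>i\<le>l. (-1) ^ i * real (l choose i) * pochhammer (real i + (x + 1)) r')"
      unfolding sum_alternating_binomial_Suc sum_distrib_left by (intro sum.cong) simp_all
    also have "\<dots> = 0" using Suc.IH[of r' "x + 1"] Suc.prems Suc by simp
    finally show ?thesis .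
  qed
qed simp

text \<open>The l-th difference of 1/x; read from right to left, a partial fraction
  expansion.\<close>

lemma sum_alternating_inverse:
  fixes x :: real
  assumes "x > 0"
  shows "(\<Sum>i\<le>l. (-1) ^ i * real (l choose i) * (1 / (real i + x))) = fact l / pochhammer x (Suc l)"
  using assms
proof (induction l arbitrary: x)
  case (Suc l)
  have "(\<Sum>i\<le>Suc l. (-1) ^ i * real (Suc l choose i) * (1 / (real i + x)))
      = (\<Sum>i\<le>l. (-1) ^ i * real (l choose i) * (1 / (real i + x)))
        - (\<Sum>i\<le>l. (-1) ^ i * real (l choose i) * (1 / (real i + (x + 1))))"
    unfolding sum_alternating_binomial_Suc sum_subtractf[symmetric]
    by (intro sum.cong) (simp_all add: algebra_simps)
  also have "\<dots> = fact l / pochhammer x (Suc l) - fact l / pochhammer (x + 1) (Suc l)"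
    using Suc.IH[of x] Suc.IH[of "x + 1"] Suc.prems by simp
  also have "\<dots> = fact (Suc l) / pochhammer x (Suc (Suc l))"
  proof -
    have pos: "pochhammer (x + 1) l > 0" using Suc.prems by (simp add: pochhammer_pos)
    have 1: "pochhammer x (Suc l) = x * pochhammer (x + 1) l" by (rule pochhammer_rec)
    have 2: "pochhammer (x + 1) (Suc l) = pochhammer (x + 1) l * (x + 1 + real l)"
      by (simp add: pochhammer_Suc)
    have 3: "pochhammer x (Suc (Suc l)) = x * pochhammer (x + 1) l * (x + 1 + real l)"
      by (subst pochhammer_rec) (simp add: pochhammer_Suc)
    have p: "x > 0" "x + 1 + real l > 0" using Suc.prems by simp_all
    have "fact l / (x * q) - fact l / (q * (x + 1 + real l)) = (1 + real l) * fact l / (x * q * (x + 1 + real l))"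
      if "q > 0" for q :: real
      using p that by (simp add: divide_simps) (simp add: algebra_simps)
    from this[OF pos] show ?thesis unfolding 1 2 3 by simp
  qed
  finally show ?case .
qed simp

lemma fact_add_pochhammer: "fact (a + i) = (fact a * pochhammer (real (a + 1)) i :: real)"
  by (induction i) (auto simp: pochhammer_Suc algebra_simps)

text \<open>Integration by parts: (1 - t)^(a + 1) (1 + t)^(b + 1) vanishes at both ends, which
  trades a factor 1 + t for a factor 1 - t until \<open>b = 0\<close>.\<close>

lemma integral_beta:
  "integral {-1..1} (\<lambda>t::real. (1 - t) ^ a * (1 + t) ^ b)
    = 2 ^ (a + b + 1) * fact a * fact b / fact (a + b + 1)"
proof (induction b arbitrary: a)
  case 0
  have "((\<lambda>t. (1 - t) ^ a) has_integral (- ((1 - 1) ^ Suc a / real (Suc a)) - - ((1 - (-1)) ^ Suc a / real (Suc a)))) {-1..1}"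
    by (intro fundamental_theorem_of_calculus)
       (auto intro!: derivative_eq_intros simp del: power_Suc of_nat_Suc
             simp flip: has_real_derivative_iff_has_vector_derivative)
  then show ?case by (simp add: integral_unique)
next
  case (Suc b)
  let ?B = "\<lambda>a b t. (1 - t) ^ a * (1 + t::real) ^ b"
  have int: "?B a b integrable_on {-1..1}" for a b
    by (intro integrable_continuous_real continuous_intros)
  have "((\<lambda>t. real (Suc b) * ?B (Suc a) b t - real (Suc a) * ?B a (Suc b) t) has_integral
      ?B (Suc a) (Suc b) 1 - ?B (Suc a) (Suc b) (-1)) {-1..1}"
    by (intro fundamental_theorem_of_calculus)
       (auto intro!: derivative_eq_intros simp del: power_Suc of_nat_Suc
             simp flip: has_real_derivative_iff_has_vector_derivative)
  then have "integral {-1..1} (\<lambda>t. real (Suc b) * ?B (Suc a) b t - real (Suc a) * ?B a (Suc b) t) = 0"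
    by (simp add: integral_unique)
  then have "real (Suc a) * integral {-1..1} (?B a (Suc b)) = real (Suc b) * integral {-1..1} (?B (Suc a) b)"
    by (subst (asm) integral_diff) (use int in \<open>auto simp del: of_nat_Suc power_Suc\<close>)
  also have "integral {-1..1} (?B (Suc a) b)
      = 2 ^ (Suc a + b + 1) * (real (Suc a) * fact a) * fact b / fact (Suc a + b + 1)"
    unfolding Suc.IH by (simp only: fact_Suc of_nat_mult)
  also have "real (Suc b) * (2 ^ (Suc a + b + 1) * (real (Suc a) * fact a) * fact b / fact (Suc a + b + 1))
      = real (Suc a) * (2 ^ (a + Suc b + 1) * fact a * fact (Suc b) / fact (a + Suc b + 1))"
    by (simp only: fact_Suc[of b] add_Suc add_Suc_right) (simp del: of_nat_Suc fact_Suc)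
  finally show ?case by (rule mult_left_cancel[THEN iffD1, rotated]) simp
qed

definition jacobi_int :: "nat \<Rightarrow> nat \<Rightarrow> real poly \<Rightarrow> real" where
  "jacobi_int a b p = integral {-1..1} (\<lambda>t. poly p t * ((1 - t) ^ a * (1 + t) ^ b))"

lemma jacobi_int_integrable:
  "(\<lambda>t. poly p t * ((1 - t) ^ a * (1 + t) ^ b)) integrable_on {-1..1::real}"
  by (intro integrable_continuous_real continuous_intros)

lemma positive_functional_jacobi_int: "positive_functional (jacobi_int a b)"
proof
  fix p q :: "real poly" and c :: real
  show "jacobi_int a b (p + q) = jacobi_int a b p + jacobi_int a b q"
    unfolding jacobi_int_def
    by (subst integral_add[symmetric]) (use jacobi_int_integrable in \<open>auto simp: distrib_right\<close>)
  show "jacobi_int a b (Polynomial.smult c p) = c * jacobi_int a b p"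
    unfolding jacobi_int_def by (simp add: mult.assoc)
  assume "p \<noteq> 0"
  let ?f = "\<lambda>t. poly (p * p) t * ((1 - t) ^ a * (1 + t) ^ b)"
  have nonneg: "?f x \<ge> 0" if "x \<in> {-1..1}" for x
    using that by simp
  have "jacobi_int a b (p * p) \<ge> 0"
    unfolding jacobi_int_def using nonneg by (rule integral_nonneg[OF jacobi_int_integrable])
  moreover have "jacobi_int a b (p * p) \<noteq> 0"
  proof
    assume "jacobi_int a b (p * p) = 0"
    moreover have "continuous_on {-1..1} ?f" by (intro continuous_intros)
    ultimately have 0: "\<forall>x\<in>{-1..1}. ?f x = 0"
      using integral_eq_0_iff[where f = ?f, OF _ _ nonneg, of "-1" 1] unfolding jacobi_int_def by simp
    have "p = 0"
    proof (rule poly_eq_0_interval[of "-1" 1])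
      fix t :: real assume "-1 < t" "t < 1"
      then show "poly p t = 0" using 0[rule_format, of t] by auto
    qed simp
    with \<open>p \<noteq> 0\<close> show False by simp
  qed
  ultimately show "jacobi_int a b (p * p) > 0" by simp
qed

text \<open>The endpoints are discarded as a null set because \<open>0 powr 0\<close> is 0 while
  \<open>0 ^ 0\<close> is 1, so that the two weights differ there when an exponent is 0.\<close>

lemma integral_jacobi_weight:
  "integral {-1..1} (\<lambda>t. f t * jacobi_weight (real a) (real b) t)
    = integral {-1..1} (\<lambda>t. f t * ((1 - t) ^ a * (1 + t) ^ b))"
proof (rule integral_spike[of "{-1, 1}"])
  show "f t * ((1 - t) ^ a * (1 + t) ^ b) = f t * jacobi_weight (real a) (real b) t"
    if "t \<in> {-1..1} - {-1, 1}" for t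
    using that by (simp add: jacobi_weight_def powr_realpow)
qed simp

text \<open>The hypergeometric form of the Jacobi polynomial, scaled to take the value 1 at 1.\<close>

definition jacobi_poly :: "nat \<Rightarrow> nat \<Rightarrow> nat \<Rightarrow> real poly" where
  "jacobi_poly a b l = (\<Sum>i\<le>l. Polynomial.smult
     ((-1) ^ i * real (l choose i) * (pochhammer (real (l + a + b + 1)) i / pochhammer (real (a + 1)) i))
     ([:1/2, - (1/2):] ^ i))"

lemma poly_jacobi_poly_1: "poly (jacobi_poly a b l) 1 = 1"
proof -
  have "poly (jacobi_poly a b l) 1 = (\<Sum>i\<le>l. if i = 0 then 1 else 0)"
    unfolding jacobi_poly_def poly_sum by (intro sum.cong) auto
  then show ?thesis by simp
qed

lemma degree_jacobi_poly_le: "degree (jacobi_poly a b l) \<le> l"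
  unfolding jacobi_poly_def
  by (intro degree_sum_le) (auto intro!: order.trans[OF degree_smult_le] simp: degree_power_eq)

lemma coeff_jacobi_poly:
  "coeff (jacobi_poly a b l) l
    = pochhammer (real (l + a + b + 1)) l / pochhammer (real (a + 1)) l / 2 ^ l"
proof -
  have *: "coeff ([:1/2, - (1/2):] ^ i :: real poly) l = (if i = l then (- (1/2)) ^ l else 0)" if "i \<le> l" for i
    using that lead_coeff_power[of "[:1/2, - (1/2)::real:]" l]
    by (auto simp: degree_power_eq intro: coeff_eq_0)
  have "coeff (jacobi_poly a b l) l = (\<Sum>i\<le>l. if i = l then 
     ((-1) ^ i * real (l choose i) * (pochhammer (real (l + a + b + 1)) i / pochhammer (real (a + 1)) i)) * (- (1/2)) ^ l else 0)"
    unfolding jacobi_poly_def coeff_sum by (intro sum.cong) (simp_all add: *)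
  moreover have "(- (1/2)) ^ l = (-1) ^ l * (1/2::real) ^ l" by (simp flip: power_mult_distrib)
  ultimately show ?thesis by (simp add: power_one_over)
qed

lemma degree_jacobi_poly: "degree (jacobi_poly a b l) = l" "lead_coeff (jacobi_poly a b l) > 0"
proof -
  have pos: "coeff (jacobi_poly a b l) l > 0"
    unfolding coeff_jacobi_poly by (intro divide_pos_pos pochhammer_pos) simp_all
  then show "degree (jacobi_poly a b l) = l"
    using degree_jacobi_poly_le[of a b l] le_degree[of "jacobi_poly a b l" l] by simp
  with pos show "lead_coeff (jacobi_poly a b l) > 0" by simp
qed

text \<open>Every term is a beta integral, and its factorials absorb the Pochhammer symbols. The
  remaining quotient is a polynomial in \<open>i\<close> of degree l - g - 1 for g < l and a
  reciprocal of a linear function for g = l, the two cases that the finite differences above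
  evaluate.\<close>

lemma jacobi_int_jacobi_poly_power:
  "jacobi_int a b (jacobi_poly a b l * [:1, 1:] ^ g)
    = 2 ^ (a + b + g + 1) * fact (b + g) * fact a / fact (l + a + b)
      * (\<Sum>i\<le>l. (-1) ^ i * real (l choose i) * (fact (l + a + b + i) / fact (a + b + g + 1 + i)))"
proof -
  interpret positive_functional "jacobi_int a b" by (rule positive_functional_jacobi_int)
  have sum: "jacobi_int a b (sum f A) = (\<Sum>i\<in>A. jacobi_int a b (f i))" if "finite A" for f :: "nat \<Rightarrow> real poly" and A
    using that by induction (simp_all add: zero add)
  have mono: "jacobi_int a b ([:1/2, - (1/2):] ^ i * [:1, 1:] ^ g)
      = 2 ^ (a + b + g + 1) * fact (a + i) * fact (b + g) / fact (a + b + g + 1 + i)" for i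
  proof -
    have "poly ([:1/2, - (1/2):] ^ i * [:1, 1:] ^ g) t * ((1 - t) ^ a * (1 + t) ^ b)
        = (1/2) ^ i * ((1 - t) ^ (a + i) * (1 + t) ^ (b + g))" for t :: real
    proof -
      have "poly [:1/2, - (1/2):] t = 1/2 * (1 - t)" "poly [:1, 1:] t = 1 + t"
        by (simp_all add: field_simps)
      then show ?thesis
        by (simp only: poly_mult poly_power power_mult_distrib power_add mult_ac)
    qed
    then have "jacobi_int a b ([:1/2, - (1/2):] ^ i * [:1, 1:] ^ g)
      = (1/2) ^ i * (2 ^ (a + i + (b + g) + 1) * fact (a + i) * fact (b + g) / fact (a + i + (b + g) + 1))"
      unfolding jacobi_int_def by (simp only: integral_mult_right integral_beta)
    then show ?thesis by (simp add: power_add power_divide add_ac)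
  qed
  show ?thesis
    unfolding jacobi_poly_def sum_distrib_right sum[OF finite_atMost] mult_smult_left smult mono sum_distrib_left
  proof (intro sum.cong refl)
    fix i
    have f1: "fact (a + i) = (fact a * pochhammer (real (a + 1)) i :: real)" by (rule fact_add_pochhammer)
    have f2: "fact (l + a + b + i) = (fact (l + a + b) * pochhammer (real (l + a + b + 1)) i :: real)"
      by (rule fact_add_pochhammer)
    have "pochhammer (real (a + 1)) i > 0" by (intro pochhammer_pos) simp
    then show "(-1) ^ i * real (l choose i) * (pochhammer (real (l + a + b + 1)) i / pochhammer (real (a + 1)) i)
        * (2 ^ (a + b + g + 1) * fact (a + i) * fact (b + g) / fact (a + b + g + 1 + i))
      = 2 ^ (a + b + g + 1) * fact (b + g) * fact a / fact (l + a + b)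
         * ((-1) ^ i * real (l choose i) * (fact (l + a + b + i) / fact (a + b + g + 1 + i)))"
      unfolding f1 f2 by simp
  qed
qed

lemma jacobi_int_jacobi_poly_power_less:
  assumes "g < l"
  shows "jacobi_int a b (jacobi_poly a b l * [:1, 1:] ^ g) = 0"
proof -
  have "(fact (l + a + b + i) / fact (a + b + g + 1 + i) :: real)
      = pochhammer (real i + real (a + b + g + 2)) (l - g - 1)" for i
  proof -
    have "fact (a + b + g + 1 + i + (l - g - 1)) = (fact (a + b + g + 1 + i)
        * pochhammer (real (a + b + g + 1 + i + 1)) (l - g - 1) :: real)"
      by (rule fact_add_pochhammer)
    moreover have "a + b + g + 1 + i + (l - g - 1) = l + a + b + i" using assms by simp
    ultimately have "fact (l + a + b + i) = (fact (a + b + g + 1 + i)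
        * pochhammer (real (a + b + g + 1 + i + 1)) (l - g - 1) :: real)" by (simp only:)
    moreover have "real (a + b + g + 1 + i + 1) = real i + real (a + b + g + 2)" by simp
    ultimately show ?thesis by (simp only: nonzero_mult_div_cancel_left fact_nonzero simp_thms)
  qed
  then show ?thesis
    unfolding jacobi_int_jacobi_poly_power
    using sum_alternating_pochhammer[of "l - g - 1" l "real (a + b + g + 2)"] assms by simp
qed

lemma jacobi_int_jacobi_poly_lower:
  assumes "degree p < l"
  shows "jacobi_int a b (jacobi_poly a b l * p) = 0"
proof -
  interpret positive_functional "jacobi_int a b" by (rule positive_functional_jacobi_int)
  have deg: "\<And>k. degree ([:1, 1::real:] ^ k) = k" and nz: "\<And>k. [:1, 1::real:] ^ k \<noteq> 0"
    by (simp_all add: degree_power_eq)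
  have "degree p \<le> l - 1" using assms by simp
  from deg nz this show ?thesis
  proof (induction p rule: poly_basis_induct)
    case (basis k)
    then show ?case using assms by (intro jacobi_int_jacobi_poly_power_less) simp
  qed (simp_all add: zero add smult distrib_left)
qed

text \<open>By orthogonality only the top coefficient of the second factor counts, so that factor
  may be replaced by a multiple of (1 + t)^l, which is the case g = l of the previous
  formula.\<close>

lemma jacobi_int_jacobi_poly_square:
  "jacobi_int a b (jacobi_poly a b l * jacobi_poly a b l)
    = 2 ^ (a + b + 1) * fact (b + l) * fact a * fact l
      / (pochhammer (real (a + 1)) l * fact (l + a + b) * real (2 * l + a + b + 1))"
proof -
  interpret positive_functional "jacobi_int a b" by (rule positive_functional_jacobi_int)
  let ?J = "jacobi_poly a b l" and ?c = "coeff (jacobi_poly a b l) l"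
  define r where "r = ?J - Polynomial.smult ?c ([:1, 1:] ^ l)"
  have "coeff ([:1, 1::real:] ^ l) l = 1"
    using lead_coeff_power[of "[:1, 1::real:]" l] by (simp add: degree_power_eq)
  then have "coeff r l = 0" by (simp add: r_def)
  moreover have "degree r \<le> l"
    unfolding r_def
    by (intro degree_diff_le) (auto intro!: degree_jacobi_poly_le order.trans[OF degree_smult_le] simp: degree_power_eq)
  ultimately have "r = 0 \<or> degree r < l"
    by (metis le_neq_implies_less leading_coeff_0_iff)
  then have r0: "jacobi_int a b (?J * r) = 0"
    using jacobi_int_jacobi_poly_lower[of r l a b] zero by auto
  have "?J * ?J = Polynomial.smult ?c (?J * [:1, 1:] ^ l) + ?J * r"
    by (simp add: r_def algebra_simps)
  then have "jacobi_int a b (?J * ?J) = ?c * jacobi_int a b (?J * [:1, 1:] ^ l)"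
    using r0 by (simp add: add smult)
  also have "(\<Sum>i\<le>l. (-1) ^ i * real (l choose i) * (fact (l + a + b + i) / fact (a + b + l + 1 + i)))
      = fact l / pochhammer (real (l + a + b + 1)) (Suc l)"
  proof -
    have "(fact (l + a + b + i) / fact (a + b + l + 1 + i) :: real) = 1 / (real i + real (l + a + b + 1))" for i
    proof -
      have "fact (a + b + l + 1 + i) = ((real i + real (l + a + b + 1)) * fact (l + a + b + i) :: real)"
        using fact_Suc[of "l + a + b + i", where 'a = real] by (simp add: add_ac)
      then show ?thesis by simp
    qed
    then show ?thesis using sum_alternating_inverse[of "real (l + a + b + 1)" l] by simp
  qed
  then have "jacobi_int a b (?J * [:1, 1:] ^ l) = 2 ^ (a + b + l + 1) * fact (b + l) * fact a / fact (l + a + b)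
      * (fact l / pochhammer (real (l + a + b + 1)) (Suc l))"
    unfolding jacobi_int_jacobi_poly_power by simp
  finally have "jacobi_int a b (?J * ?J) = ?c * (2 ^ (a + b + l + 1) * fact (b + l) * fact a / fact (l + a + b)
      * (fact l / pochhammer (real (l + a + b + 1)) (Suc l)))" .
  moreover have "pochhammer (real (l + a + b + 1)) (Suc l)
      = pochhammer (real (l + a + b + 1)) l * real (2 * l + a + b + 1)"
    by (simp add: pochhammer_Suc)
  moreover have "pochhammer (real (l + a + b + 1)) l > 0" by (intro pochhammer_pos) simp
  ultimately show ?thesis unfolding coeff_jacobi_poly
    by (simp add: power_add del: of_nat_add of_nat_Suc of_nat_mult)
qed

text \<open>\<open>W\<close> is the total mass of the weight: orthonormality refers to the
  normalized weight, which puts the mass into the numerator under the root.\<close>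

lemma jacobi_on_nat:
  defines "W \<equiv> \<lambda>a b. 2 ^ (a + b + 1) * fact a * fact b / fact (a + b + 1)"
  shows "jacobi_on (real a) (real b) l = Polynomial.smult
    (sqrt (W a b / jacobi_int a b (jacobi_poly a b l * jacobi_poly a b l))) (jacobi_poly a b l)"
proof -
  interpret J: positive_functional "jacobi_int a b" by (rule positive_functional_jacobi_int)
  have W: "W a b > 0" by (simp add: W_def)
  define \<phi> where "\<phi> p = jacobi_int a b p / W a b" for p
  interpret positive_functional \<phi>
    using W by unfold_locales (simp_all add: \<phi>_def J.add J.smult J.pos add_divide_distrib)
  define N where "N l = jacobi_int a b (jacobi_poly a b l * jacobi_poly a b l)" for l
  have nz: "jacobi_poly a b l \<noteq> 0" for l using degree_jacobi_poly(2)[of a b l] by auto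
  have N: "N l > 0" for l unfolding N_def by (intro J.pos nz)
  define C where "C l = Polynomial.smult (sqrt (W a b / N l)) (jacobi_poly a b l)" for l
  have s: "sqrt (W a b / N l) > 0" for l using W N[of l] by simp
  have "jacobi_on (real a) (real b) = C"
  proof (rule jacobi_on_eqI[of \<phi>])
    show "weighted_integral (jacobi_weight (real a) (real b)) p q / integral {-1..1} (jacobi_weight (real a) (real b))
        = \<phi> (p * q)" for p q
    proof -
      have "integral {-1..1} (jacobi_weight (real a) (real b)) = W a b"
        using integral_jacobi_weight[of "\<lambda>_. 1" a b] integral_beta[of a b]
        by (simp only: W_def mult_1)
      then show ?thesis
        by (simp add: weighted_integral_def integral_jacobi_weight \<phi>_def jacobi_int_def)
    qed
    show "orthogonal_seq C"
    proof (rule orthogonal_seqI_lower)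
      show "degree (C k) = k" for k using W N[of k] degree_jacobi_poly(1)[of a b k] by (simp add: C_def)
      show "C k \<noteq> 0" for k using W N[of k] nz by (simp add: C_def)
      show "\<phi> (C k * p) = 0" if "degree p < k" for k p
        using jacobi_int_jacobi_poly_lower[OF that] by (simp add: C_def J.smult \<phi>_def)
    qed
    show "\<phi> (C k * C k) = 1" for k
      using s[of k] W N[of k] by (simp add: C_def smult flip: mult.assoc) (simp add: \<phi>_def flip: N_def)
    show "lead_coeff (C k) > 0" for k
      using s[of k] W N[of k] degree_jacobi_poly(2)[of a b k] by (simp add: C_def)
  qed unfold_locales
  then show ?thesis by (simp add: C_def N_def)
qed

text \<open>\<open>jacobi_poly\<close> is 1 at 1, so only the normalizing factor remains. The square
  is the quantity of interest: one value at 1 comes from Marr's formula, the other from the kernel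
  on the unit circle.\<close>

lemma poly_jacobi_on_1_square:
  "(poly (jacobi_on (real a) (real b) l) 1)\<^sup>2
    = fact b * pochhammer (real (a + 1)) l * fact (l + a + b) * real (2 * l + a + b + 1)
      / (fact (a + b + 1) * fact (b + l) * fact l)"
proof -
  have p: "pochhammer (real (a + 1)) l > 0" by (intro pochhammer_pos) simp
  show ?thesis
  unfolding jacobi_on_nat poly_smult poly_jacobi_poly_1 jacobi_int_jacobi_poly_square
  using p by (simp del: of_nat_add of_nat_Suc of_nat_mult)
qed

lemma jacobi_on_lower:
  assumes "degree p < l"
  shows "jacobi_int a b (jacobi_on (real a) (real b) l * p) = 0"
proof -
  interpret J: positive_functional "jacobi_int a b" by (rule positive_functional_jacobi_int)
  show ?thesis using jacobi_int_jacobi_poly_lower[OF assms] by (simp add: jacobi_on_nat J.smult)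
qed

lemma jacobi_on_nonzero: "jacobi_on (real a) (real b) l \<noteq> 0"
proof -
  have "(poly (jacobi_on (real a) (real b) l) 1)\<^sup>2 > 0"
    unfolding poly_jacobi_on_1_square
    by (intro divide_pos_pos mult_pos_pos pochhammer_pos) auto
  then show ?thesis by auto
qed

lemma degree_jacobi_on: "degree (jacobi_on (real a) (real b) l) = l"
  using jacobi_on_nonzero[of a b l] degree_jacobi_poly(1)[of a b l] by (auto simp: jacobi_on_nat)

section \<open>Moments of polynomials on the disk\<close>

text \<open>Generating the span inductively turns claims linear in the function into rule inductions
  whose only substantial case is the monomial. \<open>S\<close> records the admissible
  exponents.\<close>

inductive_set pspan :: "(nat \<times> nat) set \<Rightarrow> (real \<times> real \<Rightarrow> real) set" for S where
  zero: "(\<lambda>_. 0) \<in> pspan S"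
| monomial: "(i, j) \<in> S \<Longrightarrow> (\<lambda>z. fst z ^ i * snd z ^ j) \<in> pspan S"
| add: "F \<in> pspan S \<Longrightarrow> G \<in> pspan S \<Longrightarrow> (\<lambda>z. F z + G z) \<in> pspan S"
| scale: "F \<in> pspan S \<Longrightarrow> (\<lambda>z. c * F z) \<in> pspan S"

definition deg_le :: "nat \<Rightarrow> (nat \<times> nat) set" where
  "deg_le d = {(i, j). i + j \<le> d}"

definition deg_eq :: "nat \<Rightarrow> (nat \<times> nat) set" where
  "deg_eq d = {(i, j). i + j = d}"

lemma pspan_subset:
  assumes "F \<in> pspan S" "S \<subseteq> T"
  shows "F \<in> pspan T"
  using assms(1) by induction (use assms(2) in \<open>auto intro: pspan.intros\<close>)

lemma deg_eq_subset: "d \<le> d' \<Longrightarrow> deg_eq d \<subseteq> deg_le d'"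
  by (auto simp: deg_le_def deg_eq_def)

lemma pspan_diff:
  assumes "F \<in> pspan S" "G \<in> pspan S"
  shows "(\<lambda>z. F z - G z) \<in> pspan S"
  using pspan.add[OF assms(1) pspan.scale[OF assms(2), of "-1"]] by simp

lemma pspan_continuous: "F \<in> pspan S \<Longrightarrow> continuous_on UNIV F"
  by (induction rule: pspan.induct) (auto intro!: continuous_intros)

lemma pspan_mult:
  assumes "F \<in> pspan A" "G \<in> pspan B"
    and AB: "\<And>i j k l. (i, j) \<in> A \<Longrightarrow> (k, l) \<in> B \<Longrightarrow> (i + k, j + l) \<in> C"
  shows "(\<lambda>z. F z * G z) \<in> pspan C"
  using assms(1)
proof induction
  case (monomial i j)
  show ?case using assms(2)
  proof induction
    case (monomial k l)
    have "(\<lambda>z. fst z ^ (i + k) * snd z ^ (j + l)) \<in> pspan C"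
      using AB[OF \<open>(i, j) \<in> A\<close> monomial] by (rule pspan.monomial)
    then show ?case by (simp add: power_add mult_ac)
  next
    case (add F G)
    then show ?case using pspan.add[OF add.IH] by (simp add: distrib_left)
  next
    case (scale F c)
    then show ?case using pspan.scale[OF scale.IH, of c] by (simp add: mult_ac)
  qed (simp add: pspan.zero)
next
  case (add F G)
  then show ?case using pspan.add[OF add.IH] by (simp add: distrib_right)
next
  case (scale F c)
  then show ?case using pspan.scale[OF scale.IH, of c] by (simp add: mult_ac)
qed (simp add: pspan.zero)

lemma pspan_mult_deg_eq:
  "F \<in> pspan (deg_eq a) \<Longrightarrow> G \<in> pspan (deg_eq b) \<Longrightarrow> (\<lambda>z. F z * G z) \<in> pspan (deg_eq (a + b))"
  by (erule pspan_mult) (auto simp: deg_eq_def)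

lemma pspan_mult_deg_le:
  "F \<in> pspan (deg_le a) \<Longrightarrow> G \<in> pspan (deg_le b) \<Longrightarrow> (\<lambda>z. F z * G z) \<in> pspan (deg_le (a + b))"
  by (erule pspan_mult) (auto simp: deg_le_def)

lemma pspan_mult_UNIV:
  "F \<in> pspan A \<Longrightarrow> G \<in> pspan B \<Longrightarrow> (\<lambda>z. F z * G z) \<in> pspan UNIV"
  by (erule pspan_mult) auto

text \<open>In polar coordinates r^j cos (j \<phi>), and r^j sin (j \<phi>) for
  \<open>harm_im\<close>. The cartesian form avoids choosing an angle.\<close>

definition harm_re :: "nat \<Rightarrow> real \<times> real \<Rightarrow> real" where
  "harm_re j z = Re (Complex (fst z) (snd z) ^ j)"

definition harm_im :: "nat \<Rightarrow> real \<times> real \<Rightarrow> real" where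
  "harm_im j z = Im (Complex (fst z) (snd z) ^ j)"

definition rsq :: "real \<times> real \<Rightarrow> real" where
  "rsq z = (fst z)\<^sup>2 + (snd z)\<^sup>2"

lemma harm_0 [simp]: "harm_re 0 z = 1" "harm_im 0 z = 0"
  by (simp_all add: harm_re_def harm_im_def)

lemma harm_Suc:
  "harm_re (Suc j) z = fst z * harm_re j z - snd z * harm_im j z"
  "harm_im (Suc j) z = fst z * harm_im j z + snd z * harm_re j z"
  by (simp_all add: harm_re_def harm_im_def)

text \<open>Real and imaginary parts of x z^(j + 1) and y z^(j + 1), with x = (z + cnj z)/2, y = (z
  - cnj z)/(2i) and z cnj z = \<open>rsq\<close>: a coordinate moves the frequency up or down by
  one.\<close>

lemma mult_harm_Suc:
  "fst z * harm_re (Suc j) z = (harm_re (Suc (Suc j)) z + rsq z * harm_re j z) / 2"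
  "fst z * harm_im (Suc j) z = (harm_im (Suc (Suc j)) z + rsq z * harm_im j z) / 2"
  "snd z * harm_re (Suc j) z = (harm_im (Suc (Suc j)) z - rsq z * harm_im j z) / 2"
  "snd z * harm_im (Suc j) z = (rsq z * harm_re j z - harm_re (Suc (Suc j)) z) / 2"
  by (simp_all add: harm_Suc rsq_def power2_eq_square algebra_simps)

lemma fst_pspan: "fst \<in> pspan (deg_eq 1)" and snd_pspan: "snd \<in> pspan (deg_eq 1)"
  using pspan.monomial[of 1 0 "deg_eq 1"] pspan.monomial[of 0 1 "deg_eq 1"]
  by (simp_all add: deg_eq_def)

lemma harm_pspan: "harm_re j \<in> pspan (deg_eq j) \<and> harm_im j \<in> pspan (deg_eq j)"
proof (induction j)
  case 0
  have "harm_re 0 = (\<lambda>z. fst z ^ 0 * snd z ^ 0)" "harm_im 0 = (\<lambda>_. 0)" by auto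
  then show ?case
    using pspan.monomial[of 0 0 "deg_eq 0"] pspan.zero[of "deg_eq 0"] by (simp add: deg_eq_def)
next
  case (Suc j)
  have "harm_re (Suc j) = (\<lambda>z. fst z * harm_re j z - snd z * harm_im j z)"
    "harm_im (Suc j) = (\<lambda>z. fst z * harm_im j z + snd z * harm_re j z)"
    by (auto simp: harm_Suc)
  then show ?case
    using pspan_mult_deg_eq[OF fst_pspan, of _ j] pspan_mult_deg_eq[OF snd_pspan, of _ j] Suc
    by (auto intro!: pspan_diff pspan.add)
qed

lemma rsq_power_pspan: "(\<lambda>z. rsq z ^ i) \<in> pspan (deg_eq (2 * i))"
proof (induction i)
  case 0
  then show ?case using pspan.monomial[of 0 0 "deg_eq 0"] by (simp add: deg_eq_def)
next
  case (Suc i)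
  have "rsq \<in> pspan (deg_eq 2)"
    using pspan.add[OF pspan_mult_deg_eq[OF fst_pspan fst_pspan] pspan_mult_deg_eq[OF snd_pspan snd_pspan]]
    by (simp add: rsq_def[abs_def] power2_eq_square numeral_2_eq_2)
  from pspan_mult_deg_eq[OF this Suc] show ?case by simp
qed

text \<open>Powers of 1 + t are the natural basis here, since t = 2 r^2 - 1 turns them into
  multiples of powers of \<open>rsq\<close>.\<close>

lemma poly_rsq_pspan:
  assumes "degree p \<le> d"
  shows "(\<lambda>z. poly p (2 * rsq z - 1)) \<in> pspan (deg_le (2 * d))"
proof -
  have deg: "\<And>k. degree ([:1, 1::real:] ^ k) = k" and nz: "\<And>k. [:1, 1::real:] ^ k \<noteq> 0"
    by (simp_all add: degree_power_eq)
  from deg nz assms show ?thesis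
  proof (induction rule: poly_basis_induct)
    case zero
    then show ?case by (simp add: pspan.zero)
  next
    case (add p q)
    then show ?case using pspan.add[OF add] by simp
  next
    case (smult c p)
    then show ?case using pspan.scale[OF smult, of c] by simp
  next
    case (basis k)
    have "(\<lambda>z. 2 ^ k * rsq z ^ k) \<in> pspan (deg_le (2 * d))"
      by (intro pspan.scale pspan_subset[OF rsq_power_pspan] deg_eq_subset) (use basis in linarith)
    then show ?case by (simp add: poly_power power_mult_distrib)
  qed
qed

section \<open>One-variable moments and their recurrences\<close>

definition ball_moment :: "nat \<Rightarrow> nat \<Rightarrow> real" where
  "ball_moment n b = integral {-1..1} (\<lambda>u. u ^ b * (1 - u\<^sup>2) ^ n)"

definition trig_moment :: "nat \<Rightarrow> nat \<Rightarrow> real" where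
  "trig_moment a b = integral {0..pi} (\<lambda>\<psi>. cos \<psi> ^ a * sin \<psi> ^ b)"

text \<open>Integration by parts in the form of an exact derivative: the function vanishes at u = 1
  and u = -1, so the two terms on the right have equal integrals.\<close>

lemma deriv_ball_moment: "((\<lambda>u. u ^ (b + 1) * (1 - u\<^sup>2) ^ (n + 1)) has_real_derivative
   real (b + 1) * (u ^ b * (1 - u\<^sup>2) ^ n) - real (b + 2 * n + 3) * (u ^ (b + 2) * (1 - u\<^sup>2) ^ n)) (at u within S)"
proof -
  have "((\<lambda>u. u ^ (b + 1) * (1 - u\<^sup>2) ^ (n + 1)) has_real_derivative
     (real (b + 1) * u ^ b) * (1 - u\<^sup>2) ^ (n + 1) + (real (n + 1) * (1 - u\<^sup>2) ^ n * (- 2 * u)) * u ^ (b + 1)) (at u within S)"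
    by (rule derivative_eq_intros refl | simp del: power_Suc)+
  then show ?thesis by (rule DERIV_cong) (simp add: algebra_simps power2_eq_square)
qed

lemma deriv_trig_moment: "((\<lambda>\<psi>. cos \<psi> ^ (a + 1) * sin \<psi> ^ (b + 1)) has_real_derivative
   real (b + 1) * (cos \<psi> ^ (a + 2) * sin \<psi> ^ b) - real (a + 1) * (cos \<psi> ^ a * sin \<psi> ^ (b + 2))) (at \<psi> within S)"
proof -
  have "((\<lambda>\<psi>. cos \<psi> ^ (a + 1) * sin \<psi> ^ (b + 1)) has_real_derivative
     (real (a + 1) * cos \<psi> ^ a * - sin \<psi>) * sin \<psi> ^ (b + 1) + (real (b + 1) * sin \<psi> ^ b * cos \<psi>) * cos \<psi> ^ (a + 1)) (at \<psi> within S)"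
    by (rule derivative_eq_intros refl | simp del: power_Suc)+
  then show ?thesis by (rule DERIV_cong) (simp add: algebra_simps power2_eq_square)
qed

lemma ball_moment_add_2: "real (b + 2 * n + 3) * ball_moment n (b + 2) = real (b + 1) * ball_moment n b"
proof -
  let ?f = "\<lambda>b u. u ^ b * (1 - u\<^sup>2) ^ n :: real"
  have int: "?f b integrable_on {-1..1}" for b
    by (intro integrable_continuous_real continuous_intros)
  have "((\<lambda>u. real (b + 1) * ?f b u - real (b + 2 * n + 3) * ?f (b + 2) u) has_integral
      1 ^ (b + 1) * (1 - 1\<^sup>2) ^ (n + 1) - (-1) ^ (b + 1) * (1 - (-1)\<^sup>2) ^ (n + 1)) {-1..1::real}"
    by (rule fundamental_theorem_of_calculus)
       (simp, rule deriv_ball_moment[THEN has_real_derivative_iff_has_vector_derivative[THEN iffD1]])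
  then have "integral {-1..1} (\<lambda>u. real (b + 1) * ?f b u - real (b + 2 * n + 3) * ?f (b + 2) u) = 0"
    by (simp add: integral_unique)
  then have "real (b + 1) * integral {-1..1} (?f b) - real (b + 2 * n + 3) * integral {-1..1} (?f (b + 2)) = 0"
    by (subst (asm) integral_diff) (use int in \<open>auto simp del: of_nat_Suc of_nat_add power_Suc\<close>)
  then show ?thesis unfolding ball_moment_def by simp
qed

lemma ball_moment_odd: "odd b \<Longrightarrow> ball_moment n b = 0"
proof (induction b rule: less_induct)
  case (less b)
  show ?case
  proof (cases "b = 1")
    case True
    have "((\<lambda>u. - 2 * real (n + 1) * (u ^ 1 * (1 - u\<^sup>2) ^ n)) has_integral
        (1 - 1\<^sup>2) ^ (n + 1) - (1 - (-1)\<^sup>2) ^ (n + 1)) {-1..1::real}"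
      by (rule fundamental_theorem_of_calculus)
         (auto intro!: derivative_eq_intros simp: algebra_simps simp del: power_Suc
               simp flip: has_real_derivative_iff_has_vector_derivative)
    from integral_unique[OF this]
    have "integral {-1..1} (\<lambda>u. - 2 * real (n + 1) * (u ^ 1 * (1 - u\<^sup>2) ^ n)) = 0"
      by simp
    then show ?thesis unfolding ball_moment_def True by (subst (asm) integral_mult_right) auto
  next
    case False
    then have "b = (b - 2) + 2" "odd (b - 2)" "b - 2 < b" using less.prems by (auto elim: oddE)
    then show ?thesis using ball_moment_add_2[of "b - 2" n] less.IH[of "b - 2"] by auto
  qed
qed

lemma trig_integrable: "(\<lambda>\<psi>. cos \<psi> ^ a * sin \<psi> ^ b) integrable_on {0..pi::real}"
  by (intro integrable_continuous_real continuous_intros)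

lemma trig_moment_parts: "real (b + 1) * trig_moment (a + 2) b = real (a + 1) * trig_moment a (b + 2)"
proof -
  let ?f = "\<lambda>a b \<psi>. cos \<psi> ^ a * sin \<psi> ^ b :: real"
  have "((\<lambda>\<psi>. real (b + 1) * ?f (a + 2) b \<psi> - real (a + 1) * ?f a (b + 2) \<psi>) has_integral
      ?f (a + 1) (b + 1) pi - ?f (a + 1) (b + 1) 0) {0..pi}"
    by (rule fundamental_theorem_of_calculus)
       (simp, rule deriv_trig_moment[THEN has_real_derivative_iff_has_vector_derivative[THEN iffD1]])
  then have "integral {0..pi} (\<lambda>\<psi>. real (b + 1) * ?f (a + 2) b \<psi> - real (a + 1) * ?f a (b + 2) \<psi>) = 0"
    by (simp add: integral_unique)
  then have "real (b + 1) * integral {0..pi} (?f (a + 2) b) - real (a + 1) * integral {0..pi} (?f a (b + 2)) = 0"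
    by (subst (asm) integral_diff) (use trig_integrable in \<open>auto simp del: of_nat_Suc of_nat_add power_Suc\<close>)
  then show ?thesis unfolding trig_moment_def by simp
qed

lemma trig_moment_split: "trig_moment a b = trig_moment (a + 2) b + trig_moment a (b + 2)"
proof -
  have "trig_moment (a + 2) b + trig_moment a (b + 2)
      = integral {0..pi} (\<lambda>\<psi>. cos \<psi> ^ (a + 2) * sin \<psi> ^ b + cos \<psi> ^ a * sin \<psi> ^ (b + 2))"
    unfolding trig_moment_def by (intro integral_add[symmetric] trig_integrable)
  also have "(\<lambda>\<psi>::real. cos \<psi> ^ (a + 2) * sin \<psi> ^ b + cos \<psi> ^ a * sin \<psi> ^ (b + 2)) = (\<lambda>\<psi>. cos \<psi> ^ a * sin \<psi> ^ b)"
  proof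
    fix \<psi> :: real
    have "c ^ (a + 2) * s ^ b + c ^ a * s ^ (b + 2) = c ^ a * s ^ b * (s\<^sup>2 + c\<^sup>2)" for c s :: real
      by (simp add: power_add algebra_simps power2_eq_square)
    from this[of "cos \<psi>" "sin \<psi>"] show "cos \<psi> ^ (a + 2) * sin \<psi> ^ b + cos \<psi> ^ a * sin \<psi> ^ (b + 2) = cos \<psi> ^ a * sin \<psi> ^ b"
      by (simp only: sin_cos_squared_add mult_1_right)
  qed
  finally show ?thesis by (simp add: trig_moment_def)
qed

lemma trig_moment_1: "trig_moment 1 b = 0"
proof -
  have "((\<lambda>\<psi>. real (b + 1) * (cos \<psi> ^ 1 * sin \<psi> ^ b)) has_integral sin pi ^ (b + 1) - sin 0 ^ (b + 1)) {0..pi}"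
    by (rule fundamental_theorem_of_calculus)
       (auto intro!: derivative_eq_intros simp del: power_Suc
             simp flip: has_real_derivative_iff_has_vector_derivative)
  from integral_unique[OF this] have "integral {0..pi} (\<lambda>\<psi>. real (b + 1) * (cos \<psi> ^ 1 * sin \<psi> ^ b)) = 0"
    by simp
  then show ?thesis unfolding trig_moment_def by (subst (asm) integral_mult_right) auto
qed

text \<open>The chord x = cos \<psi> rescaled to [-1, 1] by y = u sin \<psi>. The weight (1 - x^2 -
  y^2)^n then splits into (1 - u^2)^n and a power of sin \<psi>, which is left out.\<close>

definition chord_int :: "nat \<Rightarrow> (real \<times> real \<Rightarrow> real) \<Rightarrow> real \<Rightarrow> real" where
  "chord_int n F \<psi> = integral {-1..1} (\<lambda>u. F (cos \<psi>, sin \<psi> * u) * (1 - u\<^sup>2) ^ n)"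

text \<open>The iterated integral over the disk with weight (1 - x^2 - y^2)^n: dy and the weight
  supply sin^(2n + 1), and dx one more sine.\<close>

definition disk_int :: "nat \<Rightarrow> (real \<times> real \<Rightarrow> real) \<Rightarrow> real" where
  "disk_int n F = integral {0..pi} (\<lambda>\<psi>. chord_int n F \<psi> * sin \<psi> ^ (2 * n + 2))"

lemma chord_integrable:
  fixes F :: "real \<times> real \<Rightarrow> real"
  assumes "continuous_on UNIV F"
  shows "(\<lambda>u. F (cos \<psi>, sin \<psi> * u) * (1 - u\<^sup>2) ^ n) integrable_on {-1..1}"
proof -
  have "continuous_on {-1..1} (\<lambda>u. F (cos \<psi>, sin \<psi> * u))"
    by (rule continuous_on_compose2[OF assms]) (auto intro!: continuous_intros)
  then have "continuous_on {-1..1} (\<lambda>u. F (cos \<psi>, sin \<psi> * u) * (1 - u\<^sup>2) ^ n)"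
    by (rule continuous_on_mult) (intro continuous_intros)
  then show ?thesis by (rule integrable_continuous_real)
qed

lemma chord_int_continuous:
  assumes "continuous_on UNIV F"
  shows "continuous_on UNIV (chord_int n F)"
proof -
  have "continuous_on UNIV (\<lambda>\<psi>. integral (cbox (-1) 1) (\<lambda>u. F (cos \<psi>, sin \<psi> * u) * (1 - u\<^sup>2) ^ n))"
    by (rule integral_continuous_on_param)
       (auto simp: split_beta intro!: continuous_intros continuous_on_compose2[OF assms])
  then show ?thesis by (simp add: chord_int_def[abs_def])
qed

lemma disk_integrable:
  assumes "continuous_on UNIV F"
  shows "(\<lambda>\<psi>. chord_int n F \<psi> * sin \<psi> ^ (2 * n + 2)) integrable_on {0..pi}"
  by (intro integrable_continuous_real continuous_intros continuous_on_subset[OF chord_int_continuous[OF assms]]) auto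

lemma chord_int_add:
  assumes "continuous_on UNIV F" "continuous_on UNIV G"
  shows "chord_int n (\<lambda>z. F z + G z) \<psi> = chord_int n F \<psi> + chord_int n G \<psi>"
  unfolding chord_int_def
  by (subst integral_add[symmetric]) (use chord_integrable assms in \<open>auto simp: distrib_right\<close>)

lemma chord_int_scale: "chord_int n (\<lambda>z. c * F z) \<psi> = c * chord_int n F \<psi>"
  unfolding chord_int_def by (simp add: mult.assoc)

lemma disk_int_add:
  assumes "continuous_on UNIV F" "continuous_on UNIV G"
  shows "disk_int n (\<lambda>z. F z + G z) = disk_int n F + disk_int n G"
  unfolding disk_int_def chord_int_add[OF assms]
  by (subst integral_add[symmetric])
     (use disk_integrable assms in \<open>auto simp: distrib_right simp del: power_Suc\<close>)

lemma disk_int_scale: "disk_int n (\<lambda>z. c * F z) = c * disk_int n F"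
  unfolding disk_int_def chord_int_scale by (simp add: mult.assoc)

lemma disk_int_diff:
  assumes "continuous_on UNIV F" "continuous_on UNIV G"
  shows "disk_int n (\<lambda>z. F z - G z) = disk_int n F - disk_int n G"
  using disk_int_add[OF assms(1), of "\<lambda>z. -1 * G z"] disk_int_scale[of n "-1" G] assms(2)
  by (simp add: continuous_on_minus)

lemma chord_int_monomial:
  "chord_int n (\<lambda>z. fst z ^ a * snd z ^ b) \<psi> = cos \<psi> ^ a * sin \<psi> ^ b * ball_moment n b"
  unfolding chord_int_def ball_moment_def integral_mult_right[symmetric]
  by (intro integral_cong) (simp add: power_mult_distrib mult_ac)

lemma disk_int_monomial:
  "disk_int n (\<lambda>z. fst z ^ a * snd z ^ b) = trig_moment a (b + 2 * n + 2) * ball_moment n b"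
  unfolding disk_int_def chord_int_monomial trig_moment_def integral_mult_left[symmetric]
  by (intro integral_cong) (simp add: power_add mult_ac)

text \<open>Odd powers of u integrate to 0 along the chord, so sin \<psi> occurs only in even
  powers, which are polynomials in cos \<psi>.\<close>

lemma chord_int_poly:
  assumes "F \<in> pspan (deg_le d)"
  obtains q where "degree q \<le> d" "\<And>\<psi>. chord_int n F \<psi> = poly q (cos \<psi>)"
proof -
  have "\<exists>q. degree q \<le> d \<and> (\<forall>\<psi>. chord_int n F \<psi> = poly q (cos \<psi>))"
    using assms
  proof induction
    case zero
    then show ?case by (intro exI[of _ 0]) (simp add: chord_int_def)
  next
    case (monomial a b)
    show ?case
    proof (cases "even b")
      case False
      then show ?thesis by (intro exI[of _ 0]) (simp add: chord_int_monomial ball_moment_odd)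
    next
      case True
      then obtain c where c: "b = 2 * c" by blast
      define q where "q = Polynomial.smult (ball_moment n b) (monom 1 a * [:1, 0, -1:] ^ c)"
      have "degree (monom (1::real) a * [:1, 0, -1:] ^ c) = a + 2 * c"
        by (subst degree_mult_eq) (auto simp: degree_power_eq degree_monom_eq)
      then have "degree q \<le> d"
        using monomial c order.trans[OF degree_smult_le] by (simp add: q_def deg_le_def)
      moreover have "chord_int n (\<lambda>z. fst z ^ a * snd z ^ b) \<psi> = poly q (cos \<psi>)" for \<psi>
      proof -
        have "poly [:1, 0, -1:] (cos \<psi>) = (sin \<psi>)\<^sup>2" using sin_squared_eq[of \<psi>] by (simp add: power2_eq_square)
        then show ?thesis
          unfolding chord_int_monomial
          by (simp only: q_def c poly_smult poly_mult poly_power poly_monom power_mult mult_1) simp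
      qed
      ultimately show ?thesis by blast
    qed
  next
    case (add F G)
    then obtain p q where "degree p \<le> d" "\<And>\<psi>. chord_int n F \<psi> = poly p (cos \<psi>)"
      "degree q \<le> d" "\<And>\<psi>. chord_int n G \<psi> = poly q (cos \<psi>)" by blast
    then show ?case
      using add.hyps by (intro exI[of _ "p + q"]) (simp add: chord_int_add pspan_continuous degree_add_le)
  next
    case (scale F c)
    then obtain q where "degree q \<le> d" "\<And>\<psi>. chord_int n F \<psi> = poly q (cos \<psi>)" by blast
    then show ?case
      by (intro exI[of _ "Polynomial.smult c q"])
         (auto simp: chord_int_scale intro: order.trans[OF degree_smult_le])
  qed
  then show ?thesis using that by blast
qed

definition rotate_plane :: "real \<Rightarrow> real \<times> real \<Rightarrow> real \<times> real" where
  "rotate_plane \<theta> z = (fst z * cos \<theta> - snd z * sin \<theta>, fst z * sin \<theta> + snd z * cos \<theta>)"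

text \<open>\<open>G\<close> is x F_y - y F_x, the generator of rotations applied to
  \<open>F\<close>. On a monomial it has two terms, whose integrals agree by the recurrences of the
  trigonometric and ball moments.\<close>

lemma disk_int_rotation_derivative:
  assumes "F \<in> pspan S"
    and "\<And>z. ((\<lambda>\<theta>. F (rotate_plane \<theta> z)) has_real_derivative G z) (at 0)"
  shows "disk_int n G = 0"
proof -
  \<comment> \<open>The derivative is existentially quantified and continuous so that the rule
    induction can add derivatives of summands; uniqueness of derivatives recovers the given
    \<open>G\<close>.\<close>
  have "\<exists>G. continuous_on UNIV G \<and> disk_int n G = 0
          \<and> (\<forall>z. ((\<lambda>\<theta>. F (rotate_plane \<theta> z)) has_real_derivative G z) (at 0))"
    using assms(1)
  proof induction
    case zero
    then show ?case by (intro exI[of _ "\<lambda>_. 0"]) (simp add: disk_int_def chord_int_def)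
  next
    case (monomial a b)
    let ?G1 = "\<lambda>z. fst z ^ (a + 1) * snd z ^ (b - 1)" and ?G2 = "\<lambda>z. fst z ^ (a - 1) * snd z ^ (b + 1)"
    let ?G = "\<lambda>z::real \<times> real. real b * ?G1 z - real a * ?G2 z"
    have "continuous_on UNIV ?G" by (intro continuous_intros)
    moreover have "((\<lambda>\<theta>. fst (rotate_plane \<theta> z) ^ a * snd (rotate_plane \<theta> z) ^ b) has_real_derivative ?G z) (at 0)" for z
      unfolding rotate_plane_def by (auto intro!: derivative_eq_intros simp: algebra_simps)
    moreover have "disk_int n ?G = 0"
    proof -
      have "disk_int n ?G = real b * disk_int n ?G1 - real a * disk_int n ?G2"
        unfolding disk_int_scale[symmetric] by (intro disk_int_diff continuous_intros)
      also have "\<dots> = 0"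
      \<comment> \<open>Here the term with the truncated exponent has coefficient 0, and the other
        term is odd in one coordinate.\<close>
      proof (cases "a = 0 \<or> b = 0")
        case True
        then show ?thesis
        proof
          assume "a = 0"
          have "disk_int n ?G1 = 0"
            unfolding disk_int_monomial using \<open>a = 0\<close> trig_moment_1 by simp
          then show ?thesis using \<open>a = 0\<close> by simp
        next
          assume "b = 0"
          have "disk_int n ?G2 = 0"
            unfolding disk_int_monomial using \<open>b = 0\<close> ball_moment_odd[of 1 n] by simp
          then show ?thesis using \<open>b = 0\<close> by simp
        qed
      next
        case False
        then obtain a' b' where ab: "a = a' + 1" "b = b' + 1" by (metis Suc_eq_plus1 not0_implies_Suc)
        have t: "real (b' + 2 * n + 3) * trig_moment (a' + 2) (b' + 2 * n + 2)
            = real (a' + 1) * trig_moment a' (b' + 2 + 2 * n + 2)"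
          using trig_moment_parts[of "b' + 2 * n + 2" a'] by (simp add: add_ac)
        have m: "real (b' + 2 * n + 3) * ball_moment n (b' + 2) = real (b' + 1) * ball_moment n b'"
          by (rule ball_moment_add_2)
        let ?B = "real (b' + 2 * n + 3)"
        have "?B * (real b * disk_int n ?G1 - real a * disk_int n ?G2)
            = real (b' + 1) * ball_moment n b' * (?B * trig_moment (a' + 2) (b' + 2 * n + 2))
              - real (a' + 1) * trig_moment a' (b' + 2 + 2 * n + 2) * (?B * ball_moment n (b' + 2))"
          unfolding disk_int_monomial ab by (simp add: algebra_simps del: of_nat_add of_nat_mult of_nat_Suc)
        also have "\<dots> = 0" unfolding t m by simp
        finally show ?thesis by simp
      qed
      finally show ?thesis .
    qed
    ultimately show ?case by blast
  next
    case (add F1 F2)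
    then obtain G1 G2 where "continuous_on UNIV G1" "disk_int n G1 = 0"
      "\<And>z. ((\<lambda>\<theta>. F1 (rotate_plane \<theta> z)) has_real_derivative G1 z) (at 0)"
      "continuous_on UNIV G2" "disk_int n G2 = 0"
      "\<And>z. ((\<lambda>\<theta>. F2 (rotate_plane \<theta> z)) has_real_derivative G2 z) (at 0)" by blast
    then show ?case
      by (intro exI[of _ "\<lambda>z. G1 z + G2 z"]) (auto simp: disk_int_add intro!: DERIV_add continuous_intros)
  next
    case (scale F c)
    then obtain G where "continuous_on UNIV G" "disk_int n G = 0"
      "\<And>z. ((\<lambda>\<theta>. F (rotate_plane \<theta> z)) has_real_derivative G z) (at 0)" by blast
    then show ?case
      by (intro exI[of _ "\<lambda>z. c * G z"]) (auto simp: disk_int_scale intro!: DERIV_cmult continuous_intros)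
  qed
  then obtain G' where G': "disk_int n G' = 0"
    "\<And>z. ((\<lambda>\<theta>. F (rotate_plane \<theta> z)) has_real_derivative G' z) (at 0)" by blast
  have "G = G'" using DERIV_unique[OF assms(2) G'(2)] by blast
  then show ?thesis using G'(1) by simp
qed

text \<open>In polar coordinates this is the beta recurrence for the integral of r^(d + 1) (1 -
  r^2)^n, with homogeneity fixing the radial power. On monomials it follows from the moment
  recurrences.\<close>

lemma disk_int_mult_rsq:
  assumes "F \<in> pspan (deg_eq d)"
  shows "real (d + 2 * n + 4) * disk_int n (\<lambda>z. rsq z * F z) = real (d + 2) * disk_int n F"
  using assms
proof induction
  case zero
  then show ?case by (simp add: disk_int_def chord_int_def)
next
  case (monomial a b)
  define B where "B = b + 2 * n + 2"
  have d: "d = a + b" using monomial by (simp add: deg_eq_def)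
  have "(\<lambda>z::real \<times> real. rsq z * (fst z ^ a * snd z ^ b))
      = (\<lambda>z. fst z ^ (a + 2) * snd z ^ b + fst z ^ a * snd z ^ (b + 2))"
    by (auto simp: rsq_def power_add power2_eq_square algebra_simps)
  then have "disk_int n (\<lambda>z. rsq z * (fst z ^ a * snd z ^ b))
      = disk_int n (\<lambda>z. fst z ^ (a + 2) * snd z ^ b) + disk_int n (\<lambda>z. fst z ^ a * snd z ^ (b + 2))"
    by (simp only:) (intro disk_int_add continuous_intros)
  also have "\<dots> = trig_moment (a + 2) B * ball_moment n b + trig_moment a (B + 2) * ball_moment n (b + 2)"
  proof -
    have "b + 2 + 2 * n + 2 = B + 2" by (simp add: B_def)
    then show ?thesis unfolding disk_int_monomial B_def[symmetric] by (simp only:)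
  qed
  finally have L: "disk_int n (\<lambda>z. rsq z * (fst z ^ a * snd z ^ b))
      = trig_moment (a + 2) B * ball_moment n b + trig_moment a (B + 2) * ball_moment n (b + 2)" .
  have R: "disk_int n (\<lambda>z. fst z ^ a * snd z ^ b)
      = (trig_moment (a + 2) B + trig_moment a (B + 2)) * ball_moment n b"
    unfolding disk_int_monomial B_def[symmetric] using trig_moment_split[of a B] by simp
  have t: "real (B + 1) * trig_moment (a + 2) B = real (a + 1) * trig_moment a (B + 2)"
    by (rule trig_moment_parts)
  have m: "real (B + 1) * ball_moment n (b + 2) = real (b + 1) * ball_moment n b"
    using ball_moment_add_2[of b n] by (simp add: B_def add_ac)
  define x where "x = trig_moment a (B + 2)"
  define y where "y = ball_moment n b"
  have t': "trig_moment (a + 2) B = real (a + 1) * x / real (B + 1)"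
    using t by (simp add: x_def field_simps)
  have m': "ball_moment n (b + 2) = real (b + 1) * y / real (B + 1)"
    using m by (simp add: y_def field_simps)
  \<comment> \<open>What remains once all moments are expressed by the single trigonometric moment
    \<open>x\<close> and the single ball moment \<open>y\<close>; \<beta> stands for b + 2n +
    3.\<close>
  have "(p + \<beta> + 1) * ((p + 1) * x / \<beta> * y + x * ((q + 1) * y / \<beta>))
      = (p + q + 2) * (((p + 1) * x / \<beta> + x) * y)" if "\<beta> > 0" for p q \<beta> :: real
    using that by (simp add: field_simps)
  from this[of "real (B + 1)" "real a" "real b"]
  have "(real a + real (B + 1) + 1) * (real (a + 1) * x / real (B + 1) * y + x * (real (b + 1) * y / real (B + 1)))
      = (real a + real b + 2) * ((real (a + 1) * x / real (B + 1) + x) * y)" by (simp add: add_ac)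
  moreover have "real (d + 2 * n + 4) = real a + real (B + 1) + 1" "real (d + 2) = real a + real b + 2"
    by (simp_all add: d B_def)
  ultimately show ?case
    unfolding L R t' m' x_def[symmetric] y_def[symmetric] by (simp only:)
next
  case (add F G)
  have c: "continuous_on UNIV (\<lambda>z. rsq z * F z)" "continuous_on UNIV (\<lambda>z. rsq z * G z)"
    unfolding rsq_def by (intro continuous_intros pspan_continuous[OF add.hyps(1)] pspan_continuous[OF add.hyps(2)])+
  have "(\<lambda>z. rsq z * (F z + G z)) = (\<lambda>z. rsq z * F z + rsq z * G z)" by (simp add: distrib_left)
  then show ?case
    using add.IH disk_int_add[OF c, of n] disk_int_add[OF pspan_continuous pspan_continuous, OF add.hyps, of n]
    by (simp add: distrib_left)
next
  case (scale F c)
  have "(\<lambda>z. rsq z * (c * F z)) = (\<lambda>z. c * (rsq z * F z))" by (simp add: mult_ac)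
  then show ?case using scale.IH by (simp add: disk_int_scale mult_ac)
qed

section \<open>Gegenbauer polynomials and Marr's formula\<close>

lemma rsq_rotate_plane [simp]: "rsq (rotate_plane \<theta> z) = rsq z"
proof -
  have "(x * c - y * s)\<^sup>2 + (x * s + y * c)\<^sup>2 = (x\<^sup>2 + y\<^sup>2) * (s\<^sup>2 + c\<^sup>2)" for x y c s :: real
    by (simp add: power2_eq_square algebra_simps)
  from this[of "fst z" "cos \<theta>" "snd z" "sin \<theta>"] show ?thesis
    by (simp add: rsq_def rotate_plane_def)
qed

lemma harm_rotate_plane:
  "harm_re j (rotate_plane \<theta> z) = cos (real j * \<theta>) * harm_re j z - sin (real j * \<theta>) * harm_im j z"
  "harm_im j (rotate_plane \<theta> z) = sin (real j * \<theta>) * harm_re j z + cos (real j * \<theta>) * harm_im j z"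
proof -
  have "Complex (fst (rotate_plane \<theta> z)) (snd (rotate_plane \<theta> z)) = cis \<theta> * Complex (fst z) (snd z)"
    by (simp add: rotate_plane_def complex_eq_iff mult_ac)
  then have "Complex (fst (rotate_plane \<theta> z)) (snd (rotate_plane \<theta> z)) ^ j = cis (real j * \<theta>) * Complex (fst z) (snd z) ^ j"
    by (simp only: power_mult_distrib Complex.DeMoivre)
  then show "harm_re j (rotate_plane \<theta> z) = cos (real j * \<theta>) * harm_re j z - sin (real j * \<theta>) * harm_im j z"
    "harm_im j (rotate_plane \<theta> z) = sin (real j * \<theta>) * harm_re j z + cos (real j * \<theta>) * harm_im j z"
    by (simp_all add: harm_re_def harm_im_def)
qed

lemma continuous_on_harm: "continuous_on A (harm_re j)" "continuous_on A (harm_im j)"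
  using harm_pspan[of j] pspan_continuous continuous_on_subset by blast+

lemma continuous_on_rsq: "continuous_on A rsq"
  unfolding rsq_def[abs_def] by (intro continuous_intros)

lemma continuous_on_poly_rsq: "continuous_on A (\<lambda>z. poly p (2 * rsq z - 1))"
  by (intro continuous_intros continuous_on_rsq)

section \<open>Radial and zonal integrals over the disk\<close>

lemma disk_int_rsq_power:
  "disk_int n (\<lambda>z. rsq z ^ k) = disk_int n (\<lambda>_. 1) * fact k * fact (n + 1) / fact (n + 1 + k)"
proof (induction k)
  case (Suc k)
  have "real (2 * k + 2 * n + 4) * disk_int n (\<lambda>z. rsq z ^ Suc k) = real (2 * k + 2) * disk_int n (\<lambda>z. rsq z ^ k)"
    using disk_int_mult_rsq[OF rsq_power_pspan, of k n] by simp
  then have "real (n + 1 + Suc k) * disk_int n (\<lambda>z. rsq z ^ Suc k) = real (Suc k) * disk_int n (\<lambda>z. rsq z ^ k)"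
    by (simp add: algebra_simps)
  then have "disk_int n (\<lambda>z. rsq z ^ Suc k) = real (Suc k) * disk_int n (\<lambda>z. rsq z ^ k) / real (n + 1 + Suc k)"
    by (simp add: field_simps del: of_nat_Suc of_nat_add)
  also have "\<dots> = disk_int n (\<lambda>_. 1) * (real (Suc k) * fact k) * fact (n + 1) / (real (n + 1 + Suc k) * fact (n + 1 + k))"
    unfolding Suc.IH by (simp add: mult_ac del: of_nat_Suc of_nat_add fact_Suc)
  finally show ?case by (simp only: add_Suc_right fact_Suc[of k] fact_Suc[of "n + 1 + k"])
qed simp

text \<open>The substitution t = 2 r^2 - 1 turns r (1 - r^2)^n dr into the Jacobi weight with
  parameters n and 0. The constant is the quotient of the total masses.\<close>

lemma disk_int_radial:
  "disk_int n (\<lambda>z. poly p (2 * rsq z - 1))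
    = disk_int n (\<lambda>_. 1) * real (n + 1) / 2 ^ (n + 1) * jacobi_int n 0 p"
proof -
  have deg: "\<And>k. degree ([:1, 1::real:] ^ k) = k" and nz: "\<And>k. [:1, 1::real:] ^ k \<noteq> 0"
    by (simp_all add: degree_power_eq)
  from deg nz order_refl[of "degree p"] show ?thesis
  proof (induction rule: poly_basis_induct)
    case zero
    then show ?case by (simp add: positive_functional.zero[OF positive_functional_jacobi_int] disk_int_def chord_int_def)
  next
    case (add p q)
    then show ?case
      by (simp add: positive_functional.add[OF positive_functional_jacobi_int]
          disk_int_add continuous_on_poly_rsq distrib_left)
  next
    case (smult c p)
    then show ?case by (simp add: disk_int_scale positive_functional.smult[OF positive_functional_jacobi_int])
  next
    case (basis k)
    have "disk_int n (\<lambda>z. poly ([:1, 1:] ^ k) (2 * rsq z - 1)) = 2 ^ k * disk_int n (\<lambda>z. rsq z ^ k)"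
      unfolding disk_int_scale[symmetric] by (simp add: poly_power power_mult_distrib)
    moreover have "jacobi_int n 0 ([:1, 1:] ^ k) = 2 ^ (n + k + 1) * fact n * fact k / fact (n + k + 1)"
      using integral_beta[of n k] by (simp add: jacobi_int_def poly_power mult_ac)
    ultimately show ?case
      by (simp add: disk_int_rsq_power power_add add_ac)
  qed
qed

text \<open>Up to the factor \<open>j\<close>, the integrand is the rotation derivative of its sine
  counterpart.\<close>

lemma disk_int_zonal_0:
  assumes "j > 0"
  shows "disk_int n (\<lambda>z. poly p (2 * rsq z - 1) * harm_re j z) = 0"
proof -
  have "disk_int n (\<lambda>z. real j * (poly p (2 * rsq z - 1) * harm_re j z)) = 0"
  proof (rule disk_int_rotation_derivative)
    show "(\<lambda>z. poly p (2 * rsq z - 1) * harm_im j z) \<in> pspan UNIV"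
      by (rule pspan_mult_UNIV[OF poly_rsq_pspan[OF order_refl] conjunct2[OF harm_pspan]])
    show "((\<lambda>\<theta>. poly p (2 * rsq (rotate_plane \<theta> z) - 1) * harm_im j (rotate_plane \<theta> z)) has_real_derivative
        real j * (poly p (2 * rsq z - 1) * harm_re j z)) (at 0)" for z
      unfolding rsq_rotate_plane harm_rotate_plane by (auto intro!: derivative_eq_intros)
  qed
  then show ?thesis using assms by (simp add: disk_int_scale)
qed

text \<open>Each factor x moves the frequency \<open>j\<close> by one, and a downward move brings a
  factor \<open>rsq\<close> = (1 + t)/2. Only contributions of frequency 0 survive; reaching it
  takes at least \<open>j\<close> downward moves, and at most (g + j)/2 when \<open>g\<close> moves
  are available. With i such moves the radial integral of p (1 + t)^i remains.\<close>

lemma disk_int_zonal_vanishing: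
  assumes "\<And>i. j \<le> i \<Longrightarrow> 2 * i \<le> g + j \<Longrightarrow> jacobi_int n 0 (p * [:1, 1:] ^ i) = 0"
  shows "disk_int n (\<lambda>z. poly p (2 * rsq z - 1) * harm_re j z * fst z ^ g) = 0"
  using assms
proof (induction g arbitrary: p j)
  case 0
  then show ?case
    using 0[of 0] disk_int_radial[of n p] disk_int_zonal_0[of j n p] by (cases "j = 0") simp_all
next
  case (Suc g)
  show ?case
  proof (cases j)
    case 0
    have "(\<lambda>z. poly p (2 * rsq z - 1) * harm_re j z * fst z ^ Suc g)
        = (\<lambda>z. poly p (2 * rsq z - 1) * harm_re 1 z * fst z ^ g)"
      by (simp add: 0 harm_Suc mult_ac)
    moreover have "disk_int n (\<lambda>z. poly p (2 * rsq z - 1) * harm_re 1 z * fst z ^ g) = 0"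
      by (rule Suc.IH) (use Suc.prems 0 in auto)
    ultimately show ?thesis by simp
  next
    case j: (Suc j')
    let ?F1 = "\<lambda>z. poly p (2 * rsq z - 1) * harm_re (Suc (Suc j')) z * fst z ^ g"
    let ?F2 = "\<lambda>z. poly (p * [:1, 1:]) (2 * rsq z - 1) * harm_re j' z * fst z ^ g"
    have 1: "disk_int n ?F1 = 0"
      by (rule Suc.IH) (use Suc.prems j in auto)
    have 2: "disk_int n ?F2 = 0"
    proof (rule Suc.IH)
      fix i assume "j' \<le> i" "2 * i \<le> g + j'"
      then have "jacobi_int n 0 (p * [:1, 1:] ^ Suc i) = 0"
        by (intro Suc.prems) (use j in auto)
      then show "jacobi_int n 0 (p * [:1, 1:] * [:1, 1:] ^ i) = 0"
        by (simp only: power_Suc mult.assoc)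
    qed
    have "poly p (2 * rsq z - 1) * harm_re j z * fst z ^ Suc g = 1/2 * ?F1 z + 1/4 * ?F2 z" for z
    proof -
      have "poly p (2 * rsq z - 1) * harm_re j z * fst z ^ Suc g
          = poly p (2 * rsq z - 1) * (fst z * harm_re (Suc j') z) * fst z ^ g"
        by (simp add: j mult_ac)
      also have "\<dots> = 1/2 * ?F1 z + 1/4 * ?F2 z"
        unfolding mult_harm_Suc by (simp add: algebra_simps add_divide_distrib)
      finally show ?thesis .
    qed
    then have "disk_int n (\<lambda>z. poly p (2 * rsq z - 1) * harm_re j z * fst z ^ Suc g)
        = disk_int n (\<lambda>z. 1/2 * ?F1 z + 1/4 * ?F2 z)" by simp
    also have "\<dots> = disk_int n (\<lambda>z. 1/2 * ?F1 z) + disk_int n (\<lambda>z. 1/4 * ?F2 z)"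
      by (intro disk_int_add continuous_intros continuous_on_poly_rsq continuous_on_harm)
    also have "\<dots> = 0" unfolding disk_int_scale 1 2 by simp
    finally show ?thesis .
  qed
qed

text \<open>With exactly \<open>j\<close> factors x every move must go down, each contributing 1/2
  \<open>rsq\<close>: after one upward move the previous lemma applies with an empty range of
  i.\<close>

lemma disk_int_harm_re_power:
  "disk_int n (\<lambda>z. rsq z ^ i * harm_re j z * fst z ^ j) = (1/2) ^ j * disk_int n (\<lambda>z. rsq z ^ (i + j))"
proof (induction j arbitrary: i)
  case (Suc j)
  let ?F1 = "\<lambda>z. rsq z ^ i * harm_re (Suc (Suc j)) z * fst z ^ j"
  let ?F2 = "\<lambda>z. rsq z ^ Suc i * harm_re j z * fst z ^ j"
  have "rsq z ^ i = poly ([:1/2, 1/2:] ^ i) (2 * rsq z - 1)" for z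
    by (simp add: poly_power field_simps)
  then have 1: "disk_int n ?F1 = 0"
    using disk_int_zonal_vanishing[of "Suc (Suc j)" j n "[:1/2, 1/2:] ^ i"] by simp
  have "rsq z ^ i * harm_re (Suc j) z * fst z ^ Suc j = 1/2 * ?F1 z + 1/2 * ?F2 z" for z
  proof -
    have "rsq z ^ i * harm_re (Suc j) z * fst z ^ Suc j
        = rsq z ^ i * (fst z * harm_re (Suc j) z) * fst z ^ j"
      by (simp add: mult_ac)
    also have "\<dots> = 1/2 * ?F1 z + 1/2 * ?F2 z"
      unfolding mult_harm_Suc by (simp add: algebra_simps add_divide_distrib)
    finally show ?thesis .
  qed
  then have "disk_int n (\<lambda>z. rsq z ^ i * harm_re (Suc j) z * fst z ^ Suc j)
      = disk_int n (\<lambda>z. 1/2 * ?F1 z + 1/2 * ?F2 z)" by simp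
  also have "\<dots> = disk_int n (\<lambda>z. 1/2 * ?F1 z) + disk_int n (\<lambda>z. 1/2 * ?F2 z)"
    by (intro disk_int_add continuous_intros continuous_on_rsq continuous_on_harm)
  also have "\<dots> = 1/2 * disk_int n ?F2" unfolding disk_int_scale 1 by simp
  finally show ?case unfolding Suc.IH by simp
qed simp

lemma chord_int_mult_fst:
  "chord_int n (\<lambda>z. F z * poly p (fst z)) \<psi> = chord_int n F \<psi> * poly p (cos \<psi>)"
  unfolding chord_int_def integral_mult_left[symmetric] by (intro integral_cong) (simp add: mult_ac)

lemma disk_int_mult_fst:
  assumes "\<And>\<psi>. chord_int n F \<psi> = poly q (cos \<psi>)"
  shows "disk_int n (\<lambda>z. F z * poly p (fst z)) = gegen_int n (q * p)"
  unfolding disk_int_def gegen_int_def chord_int_mult_fst assms by simp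

text \<open>The chord degenerates to a boundary point. This evaluation fixes the scalars that
  orthogonality leaves open.\<close>

lemma chord_int_at_0: "chord_int n F 0 = F (1, 0) * ball_moment n 0"
  and chord_int_at_pi: "chord_int n F pi = F (-1, 0) * ball_moment n 0"
  by (simp_all add: chord_int_def ball_moment_def)

lemma ball_moment_0_pos: "ball_moment n 0 > 0"
proof -
  have int: "(\<lambda>u::real. u ^ 0 * (1 - u\<^sup>2) ^ n) integrable_on {-1..1}"
    by (intro integrable_continuous_real continuous_intros)
  have nonneg: "u ^ 0 * (1 - u\<^sup>2) ^ n \<ge> 0" if "u \<in> {-1..1}" for u :: real
    using that by (auto simp: abs_square_le_1 simp flip: abs_le_iff)
  have "ball_moment n 0 \<noteq> 0"
  proof
    assume "ball_moment n 0 = 0"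
    moreover have "continuous_on {-1..1} (\<lambda>u::real. u ^ 0 * (1 - u\<^sup>2) ^ n)" by (intro continuous_intros)
    then have "integral {-1..1} (\<lambda>u::real. u ^ 0 * (1 - u\<^sup>2) ^ n) = 0
        \<longleftrightarrow> (\<forall>u\<in>{-1..1}. u ^ 0 * (1 - u\<^sup>2) ^ n = (0::real))"
      by (rule integral_eq_0_iff) (simp, rule nonneg)
    ultimately have "\<forall>u\<in>{-1..1}. u ^ 0 * (1 - u\<^sup>2) ^ n = (0::real)"
      by (simp only: ball_moment_def)
    from bspec[OF this, of 0] show False by simp
  qed
  moreover have "ball_moment n 0 \<ge> 0"
    unfolding ball_moment_def using nonneg by (rule integral_nonneg[OF int])
  ultimately show ?thesis by simp
qed

lemma gegen_int_lower:
  assumes q: "\<And>\<psi>. chord_int n F \<psi> = poly q (cos \<psi>)"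
    and F: "\<And>g. g < k \<Longrightarrow> disk_int n (\<lambda>z. F z * fst z ^ g) = 0"
    and p: "degree p < k"
  shows "gegen_int n (q * p) = 0"
proof -
  interpret positive_functional "gegen_int n" by (rule positive_functional_gegen_int)
  have deg: "\<And>k. degree (monom (1::real) k) = k" and nz: "\<And>k. monom (1::real) k \<noteq> 0"
    by (simp_all add: degree_monom_eq)
  have "degree p \<le> k - 1" using p by simp
  from deg nz this show ?thesis
  proof (induction rule: poly_basis_induct)
    case (basis g)
    then have "g < k" using p by simp
    then show ?case
      using F disk_int_mult_fst[where p = "monom 1 g" and F = F, OF q] by (simp add: poly_monom)
  qed (simp_all add: zero add smult distrib_left)
qed

text \<open>The polynomials \<open>laplace_poly n k\<close> are multiples of the Gegenbauer polynomials of index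
  \<open>n + 1\<close>, by Laplace's integral \<open>\<integral> (t + i \<surd>(1 - t\<^sup>2) u)\<^sup>k (1 - u\<^sup>2)\<^sup>n du\<close>.\<close>

definition laplace_poly :: "nat \<Rightarrow> nat \<Rightarrow> real poly" where
  "laplace_poly n k = (SOME q. degree q \<le> k \<and> (\<forall>\<psi>. chord_int n (harm_re k) \<psi> = poly q (cos \<psi>)))"

lemma degree_laplace_poly_le: "degree (laplace_poly n k) \<le> k"
  and chord_int_harm_re: "chord_int n (harm_re k) \<psi> = poly (laplace_poly n k) (cos \<psi>)"
proof -
  have "harm_re k \<in> pspan (deg_le k)"
    using harm_pspan pspan_subset deg_eq_subset by blast
  then obtain q where "degree q \<le> k \<and> (\<forall>\<psi>. chord_int n (harm_re k) \<psi> = poly q (cos \<psi>))"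
    using chord_int_poly[of "harm_re k" k n] by metis
  then have "degree (laplace_poly n k) \<le> k \<and> (\<forall>\<psi>. chord_int n (harm_re k) \<psi> = poly (laplace_poly n k) (cos \<psi>))"
    unfolding laplace_poly_def by (rule someI)
  then show "degree (laplace_poly n k) \<le> k"
    "chord_int n (harm_re k) \<psi> = poly (laplace_poly n k) (cos \<psi>)" by auto
qed

lemma harm_re_unit: "harm_re k (1, 0) = 1" "harm_re k (-1, 0) = (-1) ^ k"
proof -
  have "Complex 1 0 = 1" "Complex (-1) 0 = -1" by (simp_all add: complex_eq_iff)
  then show "harm_re k (1, 0) = 1" "harm_re k (-1, 0) = (-1) ^ k"
    by (simp_all add: harm_re_def minus_one_power_iff)
qed

lemma poly_laplace_poly_1: "poly (laplace_poly n k) 1 = ball_moment n 0"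
  using chord_int_harm_re[of n k 0] by (simp add: chord_int_at_0 harm_re_unit)

lemma poly_laplace_poly_minus_1: "poly (laplace_poly n k) (-1) = (-1) ^ k * ball_moment n 0"
  using chord_int_harm_re[of n k pi] by (simp add: chord_int_at_pi harm_re_unit)

text \<open>Fewer than \<open>k\<close> factors x cannot bring the frequency \<open>k\<close> down
  to 0, so the hypothesis of \<open>disk_int_zonal_vanishing\<close> is vacuous.\<close>

lemma gegen_int_laplace_poly_lower:
  assumes "degree p < k"
  shows "gegen_int n (laplace_poly n k * p) = 0"
proof (rule gegen_int_lower[OF chord_int_harm_re _ assms])
  fix g assume "g < k"
  then show "disk_int n (\<lambda>z. harm_re k z * fst z ^ g) = 0"
    using disk_int_zonal_vanishing[of k g n 1] by simp
qed

lemma laplace_poly_nonzero: "laplace_poly n k \<noteq> 0"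
  using poly_laplace_poly_1[of n k] ball_moment_0_pos[of n] by (metis less_irrefl poly_0)

lemma degree_laplace_poly: "degree (laplace_poly n k) = k"
proof (rule ccontr)
  interpret positive_functional "gegen_int n" by (rule positive_functional_gegen_int)
  assume "degree (laplace_poly n k) \<noteq> k"
  then have "degree (laplace_poly n k) < k" using degree_laplace_poly_le[of n k] by simp
  then have "gegen_int n (laplace_poly n k * laplace_poly n k) = 0" by (rule gegen_int_laplace_poly_lower)
  then show False using laplace_poly_nonzero eq_0_iff by blast
qed

lemma orthogonal_seq_laplace_poly:
  "positive_functional.orthogonal_seq (gegen_int n) (laplace_poly n)"
proof -
  interpret positive_functional "gegen_int n" by (rule positive_functional_gegen_int)
  show ?thesis
    by (rule orthogonal_seqI_lower)
       (simp_all add: degree_laplace_poly laplace_poly_nonzero gegen_int_laplace_poly_lower)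
qed

definition gegenbauer_1 :: "nat \<Rightarrow> nat \<Rightarrow> real" where
  "gegenbauer_1 n k = pochhammer (2 * real (n + 1)) k / fact k"

lemma gegenbauer_1_pos: "gegenbauer_1 n k > 0"
  by (simp add: gegenbauer_1_def pochhammer_pos)

lemma gegenbauer_nat:
  "gegenbauer (real n + 1) k = Polynomial.smult (gegenbauer_1 n k / ball_moment n 0) (laplace_poly n k)"
proof -
  interpret positive_functional "gegen_int n" by (rule positive_functional_gegen_int)
  have c: "gegenbauer_1 n k / ball_moment n 0 \<noteq> 0" for k
    using gegenbauer_1_pos[of n k] ball_moment_0_pos[of n] by simp
  have "gegenbauer (real n + 1) = (\<lambda>k. Polynomial.smult (gegenbauer_1 n k / ball_moment n 0) (laplace_poly n k))"
  proof (rule gegenbauer_eqI)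
    show "positive_functional (gegen_int n)" by unfold_locales
    have e: "real n + 1 - 1/2 = real n + 1/2" by simp
    show "weighted_integral (\<lambda>s. (1 - s\<^sup>2) powr (real n + 1 - 1/2)) p q = gegen_int n (p * q)" for p q
      unfolding weighted_integral_def gegen_int_eq_weighted[symmetric] poly_mult e ..
    show "orthogonal_seq (\<lambda>k. Polynomial.smult (gegenbauer_1 n k / ball_moment n 0) (laplace_poly n k))"
      by (rule orthogonal_seqI_lower)
         (use c in \<open>simp_all add: degree_laplace_poly laplace_poly_nonzero gegen_int_laplace_poly_lower smult\<close>)
    show "poly (Polynomial.smult (gegenbauer_1 n k / ball_moment n 0) (laplace_poly n k)) 1
        = pochhammer (2 * (real n + 1)) k / fact k" for k
      using ball_moment_0_pos[of n] by (simp add: poly_laplace_poly_1 gegenbauer_1_def add_ac)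
  qed simp
  then show ?thesis by simp
qed

text \<open>Marr's formula in direction 0. By \<open>disk_int_zonal_vanishing\<close> orthogonality
  concerns p (1 + t)^i with i \<ge> j: \<open>j\<close> of these factors change the Jacobi weight
  from (n, 0) to (n, j), and the other i - j are fewer than \<open>l\<close>, so Jacobi
  orthogonality applies. Evaluation at \<psi> = 0 gives the scalar.\<close>

lemma chord_int_zonal:
  "chord_int n (\<lambda>z. poly (jacobi_on (real n) (real j) l) (2 * rsq z - 1) * harm_re j z) \<psi>
    = poly (jacobi_on (real n) (real j) l) 1 * poly (laplace_poly n (2 * l + j)) (cos \<psi>)"
proof -
  interpret positive_functional "gegen_int n" by (rule positive_functional_gegen_int)
  let ?p = "jacobi_on (real n) (real j) l"
  let ?F = "\<lambda>z. poly ?p (2 * rsq z - 1) * harm_re j z"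
  let ?k = "2 * l + j"
  have "(\<lambda>z. poly ?p (2 * rsq z - 1)) \<in> pspan (deg_le (2 * l))"
    by (rule poly_rsq_pspan) (simp add: degree_jacobi_on)
  moreover have "harm_re j \<in> pspan (deg_le j)"
    using harm_pspan pspan_subset deg_eq_subset by blast
  ultimately have "?F \<in> pspan (deg_le ?k)" by (rule pspan_mult_deg_le)
  then obtain q where q: "degree q \<le> ?k" "\<And>\<psi>. chord_int n ?F \<psi> = poly q (cos \<psi>)"
    using chord_int_poly by blast
  have "gegen_int n (q * r) = 0" if "degree r < ?k" for r
  proof (rule gegen_int_lower[OF q(2) _ that])
    fix g assume g: "g < ?k"
    show "disk_int n (\<lambda>z. ?F z * fst z ^ g) = 0"
    proof (rule disk_int_zonal_vanishing)
      fix i assume i: "j \<le> i" "2 * i \<le> g + j"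
      have "jacobi_int n 0 (?p * [:1, 1:] ^ i) = jacobi_int n j (?p * [:1, 1:] ^ (i - j))"
      proof -
        have "[:1, 1::real:] ^ i = [:1, 1:] ^ (i - j) * [:1, 1:] ^ j" using i by (simp flip: power_add)
        then show ?thesis by (simp add: jacobi_int_def poly_power mult_ac)
      qed
      also have "\<dots> = 0" by (rule jacobi_on_lower) (use i g in \<open>simp add: degree_power_eq\<close>)
      finally show "jacobi_int n 0 (?p * [:1, 1:] ^ i) = 0" .
    qed
  qed
  then obtain c where c: "q = Polynomial.smult c (laplace_poly n ?k)"
    using orthogonal_seq_multiple[OF orthogonal_seq_laplace_poly q(1)] by blast
  have "poly ?p 1 * ball_moment n 0 = c * ball_moment n 0"
    using q(2)[of 0] by (simp add: chord_int_at_0 harm_re_unit rsq_def c poly_laplace_poly_1)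
  then have "c = poly ?p 1" using ball_moment_0_pos[of n] by simp
  then show ?thesis using q(2)[of \<psi>] c by simp
qed

section \<open>Norms of the Gegenbauer polynomials\<close>

definition laplace_moment :: "nat \<Rightarrow> nat \<Rightarrow> real" where
  "laplace_moment n k = gegen_int n (laplace_poly n k * monom 1 k)"

lemma gegen_int_laplace_poly:
  assumes "degree p \<le> k"
  shows "gegen_int n (laplace_poly n k * p) = coeff p k * laplace_moment n k"
proof -
  interpret positive_functional "gegen_int n" by (rule positive_functional_gegen_int)
  define r where "r = p - Polynomial.smult (coeff p k) (monom 1 k)"
  have "coeff r k = 0" by (simp add: r_def)
  moreover have "degree r \<le> k"
    unfolding r_def using assms
    by (intro degree_diff_le) (auto intro!: order.trans[OF degree_smult_le] degree_monom_le)
  ultimately have "r = 0 \<or> degree r < k"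
    by (metis le_neq_implies_less leading_coeff_0_iff)
  then have "gegen_int n (laplace_poly n k * r) = 0"
    using gegen_int_laplace_poly_lower[of r k n] zero by auto
  moreover have "p = r + Polynomial.smult (coeff p k) (monom 1 k)" by (simp add: r_def)
  ultimately show ?thesis
    by (metis add add_0 distrib_left laplace_moment_def mult_smult_right smult)
qed

text \<open>As a disk integral this pairs Re z^k with x^k, which reduces to a radial moment.\<close>

lemma laplace_moment_eq:
  "laplace_moment n k = disk_int n (\<lambda>_. 1) * (1/2) ^ k * fact k * fact (n + 1) / fact (n + 1 + k)"
proof -
  have "laplace_moment n k = disk_int n (\<lambda>z. harm_re k z * poly (monom 1 k) (fst z))"
    unfolding laplace_moment_def by (rule disk_int_mult_fst[OF chord_int_harm_re, symmetric])
  also have "\<dots> = (1/2) ^ k * disk_int n (\<lambda>z. rsq z ^ k)"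
    using disk_int_harm_re_power[of n 0 k] by (simp add: poly_monom)
  finally show ?thesis by (simp add: disk_int_rsq_power mult_ac del: fact_Suc)
qed

lemma laplace_moment_Suc:
  "laplace_moment n (Suc k) = real (Suc k) / (2 * real (n + 1 + Suc k)) * laplace_moment n k"
proof -
  have "laplace_moment n (Suc k) = disk_int n (\<lambda>_. 1) * ((1/2) ^ k / 2) * (real (Suc k) * fact k) * fact (n + 1)
      / (real (n + 1 + Suc k) * fact (n + 1 + k))"
    unfolding laplace_moment_eq by (simp only: add_Suc_right fact_Suc[of k] fact_Suc[of "n + 1 + k"]) simp
  then show ?thesis unfolding laplace_moment_eq by (simp add: mult_ac del: of_nat_Suc of_nat_add fact_Suc)
qed

text \<open>In \<open>t q\<^sub>k = \<alpha> q\<^sub>k\<^sub>+\<^sub>1 + \<gamma> q\<^sub>k + \<beta> q\<^sub>k\<^sub>-\<^sub>1\<close> the coefficient \<open>\<beta>\<close> is a quotient of moments, and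
  evaluation at \<open>1\<close> and \<open>-1\<close> gives \<open>\<gamma> = 0\<close> and \<open>\<alpha> = 1 - \<beta>\<close>.\<close>

lemma lead_coeff_laplace_poly_Suc:
  "coeff (laplace_poly n (Suc k)) (Suc k) * (2 * real n + 2 + real k)
    = coeff (laplace_poly n k) k * (2 * (real n + 1 + real k))"
proof -
  interpret positive_functional "gegen_int n" by (rule positive_functional_gegen_int)
  let ?q = "laplace_poly n" and ?M = "ball_moment n 0"
  define \<alpha> where "\<alpha> = coeff (?q k) k / coeff (?q (Suc k)) (Suc k)"
  define \<beta> where "\<beta> = real k / (2 * real (n + 1 + k))"
  \<comment> \<open>\<open>\<alpha>\<close> cancels the coefficient of degree k + 1,
    \<open>\<beta>\<close> the pairing with degree k - 1. At \<open>k = 0\<close> the truncated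
    index \<open>k - 1\<close> comes with \<open>\<beta> = 0\<close>.\<close>
  define E where "E = pCons 0 (?q k) - Polynomial.smult \<alpha> (?q (Suc k)) - Polynomial.smult \<beta> (?q (k - 1))"
  have lc: "coeff (?q k) k \<noteq> 0" for k
    using laplace_poly_nonzero[of n k] degree_laplace_poly[of n k] by (metis leading_coeff_0_iff)
  have deg: "coeff (?q j) i = 0" if "j < i" for i j
    using that by (intro coeff_eq_0) (simp add: degree_laplace_poly)
  have "degree E \<le> k"
  proof (rule degree_le, intro allI impI)
    fix i assume "k < i"
    then obtain i' where i': "i = Suc i'" "k \<le> i'" by (metis Suc_le_D less_Suc_eq_le Suc_leI)
    show "coeff E i = 0"
    proof (cases "i' = k")
      case True
      then show ?thesis using lc[of "Suc k"] by (simp add: E_def i' \<alpha>_def deg)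
    next
      case False
      then show ?thesis using i' by (simp add: E_def deg)
    qed
  qed
  moreover have "gegen_int n (E * p) = 0" if p: "degree p < k" for p
  proof -
    obtain k' where k: "k = Suc k'" using p by (cases k) auto
    have 1: "gegen_int n (?q k * pCons 0 p) = coeff p k' * laplace_moment n k"
      using p by (subst gegen_int_laplace_poly) (simp_all add: k)
    have 2: "gegen_int n (?q (Suc k) * p) = 0"
      using p by (intro gegen_int_laplace_poly_lower) simp
    have 3: "gegen_int n (?q k' * p) = coeff p k' * laplace_moment n k'"
      using p k by (intro gegen_int_laplace_poly) simp
    have "E * p = ?q k * pCons 0 p - Polynomial.smult \<alpha> (?q (Suc k) * p) - Polynomial.smult \<beta> (?q k' * p)"
      by (simp add: E_def k left_diff_distrib)
    then have "gegen_int n (E * p) = coeff p k' * laplace_moment n k - \<beta> * (coeff p k' * laplace_moment n k')"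
      using 1 2 3 by (simp add: diff smult)
    also have "laplace_moment n k = \<beta> * laplace_moment n k'"
      unfolding k laplace_moment_Suc \<beta>_def by simp
    finally show ?thesis by simp
  qed
  ultimately obtain c where c: "E = Polynomial.smult c (?q k)"
    using orthogonal_seq_multiple[OF orthogonal_seq_laplace_poly] by blast
  have M: "?M > 0" by (rule ball_moment_0_pos)
  have "poly E 1 = (1 - \<alpha> - \<beta>) * ?M"
    by (simp add: E_def poly_laplace_poly_1 algebra_simps)
  then have c1: "c = 1 - \<alpha> - \<beta>" using M by (simp add: c poly_laplace_poly_1)
  have "poly E (-1) = - ((-1) ^ k * (1 - \<alpha> - \<beta>) * ?M)"
  proof (cases k)
    case 0
    then show ?thesis by (simp add: E_def poly_laplace_poly_minus_1 \<beta>_def algebra_simps)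
  next
    case (Suc k')
    then show ?thesis by (simp add: E_def poly_laplace_poly_minus_1 algebra_simps)
  qed
  then have "(c + (1 - \<alpha> - \<beta>)) * ((-1) ^ k * ?M) = 0"
    by (simp add: c poly_laplace_poly_minus_1 algebra_simps)
  then have "c + (1 - \<alpha> - \<beta>) = 0" using M by simp
  with c1 have "\<alpha> = 1 - \<beta>" by simp
  moreover have "1 - \<beta> = (2 * real n + 2 + real k) / (2 * (real n + 1 + real k))"
    by (simp add: \<beta>_def field_simps)
  ultimately show ?thesis using lc[of "Suc k"]
    by (simp add: \<alpha>_def field_simps)
qed

lemma trig_moment_0_Suc: "real (b + 2) * trig_moment 0 (b + 2) = real (b + 1) * trig_moment 0 b"
proof -
  have "real (b + 1) * trig_moment 2 b = trig_moment 0 (b + 2)"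
    using trig_moment_parts[of b 0] unfolding add_0 by simp
  moreover have "real (b + 1) * trig_moment 0 b = real (b + 1) * trig_moment 2 b + real (b + 1) * trig_moment 0 (b + 2)"
    using trig_moment_split[of 0 b] unfolding add_0 by (simp only: distrib_left)
  ultimately show ?thesis by (simp add: algebra_simps)
qed

lemma ball_moment_Suc_0: "real (2 * n + 3) * ball_moment (Suc n) 0 = real (2 * n + 2) * ball_moment n 0"
proof -
  have int: "(\<lambda>u::real. u ^ b * (1 - u\<^sup>2) ^ n) integrable_on {-1..1}" for b
    by (intro integrable_continuous_real continuous_intros)
  have "ball_moment (Suc n) 0 = integral {-1..1} (\<lambda>u. u ^ 0 * (1 - u\<^sup>2) ^ n - u ^ 2 * (1 - u\<^sup>2) ^ n)"
    unfolding ball_moment_def by (intro integral_cong) (simp add: algebra_simps)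
  also have "\<dots> = ball_moment n 0 - ball_moment n 2"
    unfolding ball_moment_def by (intro integral_diff int)
  finally have "ball_moment (Suc n) 0 = ball_moment n 0 - ball_moment n 2" .
  moreover have "real (2 * n + 3) * ball_moment n 2 = ball_moment n 0"
    using ball_moment_add_2[of 0 n] unfolding add_0 by simp
  ultimately have "real (2 * n + 3) * ball_moment (Suc n) 0 = real (2 * n + 3) * ball_moment n 0 - ball_moment n 0"
    by (simp only: right_diff_distrib)
  then show ?thesis by (simp add: algebra_simps)
qed

lemma disk_int_1_eq_moments: "disk_int n (\<lambda>_. 1) = trig_moment 0 (2 * n + 2) * ball_moment n 0"
  using disk_int_monomial[of n 0 0] by simp

text \<open>The weighted area 1 / a_\<mu> of the disk. The induction multiplies two Wallis-type
  recurrences, one for powers of the sine and one for powers of 1 - u^2.\<close>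

lemma disk_int_1: "real (n + 1) * disk_int n (\<lambda>_. 1) = pi"
proof (induction n)
  case 0
  have "ball_moment 0 0 = 2" by (simp add: ball_moment_def)
  moreover have "trig_moment 0 0 = pi" by (simp add: trig_moment_def)
  ultimately show ?case using trig_moment_0_Suc[of 0] by (simp add: disk_int_1_eq_moments numeral_2_eq_2)
next
  case (Suc n)
  let ?t = "trig_moment 0 (2 * n + 2)" and ?b = "ball_moment n 0"
  have t: "real (2 * n + 4) * trig_moment 0 (2 * Suc n + 2) = real (2 * n + 3) * ?t"
    using trig_moment_0_Suc[of "2 * n + 2"] by (simp add: add_ac)
  have "real (2 * n + 3) * (real (2 * n + 4) * disk_int (Suc n) (\<lambda>_. 1))
      = (real (2 * n + 4) * trig_moment 0 (2 * Suc n + 2)) * (real (2 * n + 3) * ball_moment (Suc n) 0)"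
    unfolding disk_int_1_eq_moments by (simp only: mult_ac)
  also have "\<dots> = real (2 * n + 3) * (2 * (real (n + 1) * (?t * ?b)))"
    unfolding t ball_moment_Suc_0 by (simp add: algebra_simps)
  also have "?t * ?b = disk_int n (\<lambda>_. 1)" by (simp add: disk_int_1_eq_moments)
  finally have "real (2 * n + 4) * disk_int (Suc n) (\<lambda>_. 1) = 2 * pi"
    unfolding Suc.IH by (simp only: mult_cancel_left) simp
  moreover have "real (2 * n + 4) = 2 * real (Suc n + 1)" by simp
  ultimately show ?case by (simp only: mult.assoc mult_cancel_left) simp
qed

text \<open>The left side does not change with \<open>k\<close>: the recurrences for the leading
  coefficient, the moment and the value at 1 cancel. At k = 0 it is the weighted area. One factor
  \<open>gegenbauer_1\<close> occurs because the quadrature pairs one \<open>laplace_poly\<close>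
  with one normalized Gegenbauer polynomial.\<close>

lemma laplace_poly_norm:
  "(real n + 1 + real k) * gegenbauer_1 n k * gegen_int n (laplace_poly n k * laplace_poly n k)
    = pi * ball_moment n 0"
proof -
  have N: "gegen_int n (laplace_poly n k * laplace_poly n k) = coeff (laplace_poly n k) k * laplace_moment n k" for k
    by (rule gegen_int_laplace_poly) (simp add: degree_laplace_poly)
  show ?thesis
    unfolding N
  proof (induction k)
    case 0
    have "laplace_poly n 0 = [:ball_moment n 0:]"
      using poly_laplace_poly_1[of n 0] degree_laplace_poly[of n 0] by (auto elim: degree_eq_zeroE)
    then show ?case
      using disk_int_1[of n] by (simp add: gegenbauer_1_def laplace_moment_eq add.commute del: fact_Suc)
  next
    case (Suc k)
    have c: "coeff (laplace_poly n (Suc k)) (Suc k)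
        = coeff (laplace_poly n k) k * (2 * (real n + 1 + real k)) / (2 * real n + 2 + real k)"
      using lead_coeff_laplace_poly_Suc[of n k] by (simp add: field_simps)
    have m: "laplace_moment n (Suc k) = (real k + 1) / (2 * (real n + 2 + real k)) * laplace_moment n k"
      unfolding laplace_moment_Suc by (simp add: add_ac)
    have g: "gegenbauer_1 n (Suc k) = gegenbauer_1 n k * (2 * real n + 2 + real k) / (real k + 1)"
      by (simp add: gegenbauer_1_def pochhammer_Suc field_simps)
    have "(real n + 1 + real (Suc k)) * gegenbauer_1 n (Suc k)
          * (coeff (laplace_poly n (Suc k)) (Suc k) * laplace_moment n (Suc k))
        = (real n + 1 + real k) * gegenbauer_1 n k * (coeff (laplace_poly n k) k * laplace_moment n k)"
    proof -
      \<comment> \<open>A = n + 1 + k, B = 2n + 2 + k and K = k + 1; the step from k to k + 1 raises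
        A by one.\<close>
      have "(A + 1) * (G * B / K) * (L * (2 * A) / B * (K / (2 * (A + 1)) * M)) = A * G * (L * M)"
        if "A > 0" "B > 0" "K > 0" for A B G K L M :: real
        using that by (simp add: divide_simps)
      from this[of "real n + 1 + real k" "2 * real n + 2 + real k" "real k + 1"]
      show ?thesis unfolding c m g by (simp add: add_ac)
    qed
    then show ?case using Suc.IH by simp
  qed
qed

section \<open>The reconstruction operator\<close>

lemma continuous_on_rotate_plane:
  assumes "continuous_on UNIV F"
  shows "continuous_on UNIV (\<lambda>z. F (rotate_plane \<theta> z))"
  unfolding rotate_plane_def
  by (rule continuous_on_compose2[OF assms]) (auto intro!: continuous_intros)

lemma radon_proj_cos:
  fixes F :: "real \<times> real \<Rightarrow> real"
  assumes F: "continuous_on UNIV F" and \<psi>: "0 < \<psi>" "\<psi> < pi"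
  shows "radon_proj (real n + 1/2) \<theta> F (cos \<psi>)
    = sin \<psi> ^ (2 * n + 1) * chord_int n (\<lambda>z. F (rotate_plane \<theta> z)) \<psi>"
proof -
  define S where "S = sin \<psi>"
  have S: "S > 0" using \<psi> sin_gt_zero by (simp add: S_def)
  have S2: "S\<^sup>2 = 1 - (cos \<psi>)\<^sup>2" by (simp add: S_def sin_squared_eq)
  have sq: "sqrt (1 - (cos \<psi>)\<^sup>2) = S" using S S2 by (metis abs_of_pos real_sqrt_abs)
  define G where "G = (\<lambda>s. F (rotate_plane \<theta> (cos \<psi>, s)))"
  have G: "continuous_on A G" for A
    unfolding G_def
    by (rule continuous_on_compose2[OF continuous_on_rotate_plane[OF F]]) (auto intro!: continuous_intros)
  let ?f = "\<lambda>s. G s * (S\<^sup>2 - s\<^sup>2) ^ n"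
  have "radon_proj (real n + 1/2) \<theta> F (cos \<psi>)
      = integral {-S..S} (\<lambda>s. G s * (1 - s\<^sup>2 - (cos \<psi>)\<^sup>2) powr (real n))"
    by (simp add: radon_proj_def sq G_def rotate_plane_def)
  also have "\<dots> = integral {-S..S} ?f"
  \<comment> \<open>At the ends the base is 0, where \<open>powr\<close> and \<open>^\<close>
    disagree for n = 0.\<close>
  proof (rule integral_spike[of "{-S, S}"])
    fix s assume "s \<in> {-S..S} - {-S, S}"
    then have "\<bar>s\<bar> < \<bar>S\<bar>" using S by auto
    then have "\<bar>s\<bar>\<^sup>2 < \<bar>S\<bar>\<^sup>2" by (intro power_strict_mono) auto
    then have "s\<^sup>2 < S\<^sup>2" by simp
    moreover have "1 - s\<^sup>2 - (cos \<psi>)\<^sup>2 = S\<^sup>2 - s\<^sup>2" using S2 by simp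
    ultimately show "G s * (S\<^sup>2 - s\<^sup>2) ^ n = G s * (1 - s\<^sup>2 - (cos \<psi>)\<^sup>2) powr (real n)"
      by (simp only: powr_realpow diff_gt_0_iff_gt)
  qed simp
  also have "\<dots> = integral {-1..1} (\<lambda>u. S * ?f (S * u))"
  proof -
    have "((\<lambda>u. S *\<^sub>R ?f (S * u)) has_integral integral {S * (-1)..S * 1} ?f) {-1..1}"
    proof (rule has_integral_substitution)
      show "(\<lambda>u. S * u) ` {-1..1} \<subseteq> {-S..S}"
        using S mult_left_mono[of _ 1 S] mult_left_mono[of "-1" _ S] by fastforce
      show "continuous_on {-S..S} ?f" by (intro continuous_intros G)
    qed (use S in \<open>auto intro!: derivative_eq_intros\<close>)
    from integral_unique[OF this] show ?thesis by simp
  qed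
  also have "\<dots> = integral {-1..1} (\<lambda>u. S ^ (2 * n + 1) * (F (rotate_plane \<theta> (cos \<psi>, S * u)) * (1 - u\<^sup>2) ^ n))"
  proof (intro integral_cong)
    fix u :: real
    have "S\<^sup>2 - (S * u)\<^sup>2 = S\<^sup>2 * (1 - u\<^sup>2)" by (simp add: power_mult_distrib algebra_simps)
    then have "(S\<^sup>2 - (S * u)\<^sup>2) ^ n = S ^ (2 * n) * (1 - u\<^sup>2) ^ n"
      by (simp add: power_mult_distrib power_mult)
    then show "S * ?f (S * u) = S ^ (2 * n + 1) * (F (rotate_plane \<theta> (cos \<psi>, S * u)) * (1 - u\<^sup>2) ^ n)"
      by (simp add: G_def)
  qed
  finally show ?thesis by (simp add: chord_int_def S_def)
qed

text \<open>The basis function without its constant \<open>h_const\<close>, indexed by the frequency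
  j = k - 2l in place of the degree.\<close>

definition disk_basis :: "nat \<Rightarrow> nat \<Rightarrow> nat \<Rightarrow> nat \<Rightarrow> real \<times> real \<Rightarrow> real" where
  "disk_basis n l j \<epsilon> z = poly (jacobi_on (real n) (real j) l) (2 * rsq z - 1)
     * (if \<epsilon> = 0 then harm_re j z else harm_im j z)"

lemma continuous_on_disk_basis: "continuous_on A (disk_basis n l j \<epsilon>)"
  unfolding disk_basis_def[abs_def]
  by (cases "\<epsilon> = 0") (auto intro!: continuous_on_mult continuous_on_poly_rsq continuous_on_harm)

text \<open>Reflection in the x-axis conjugates z, so the integrand is odd in u.\<close>

lemma chord_int_radial_harm_im: "chord_int n (\<lambda>z. poly p (2 * rsq z - 1) * harm_im j z) \<psi> = 0"
proof -
  let ?f = "\<lambda>u. poly p (2 * rsq (cos \<psi>, sin \<psi> * u) - 1) * harm_im j (cos \<psi>, sin \<psi> * u) * (1 - u\<^sup>2) ^ n"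
  have "harm_im j (x, - y) = - harm_im j (x, y)" for x y
  proof -
    have "Complex x (- y) = cnj (Complex x y)" by (simp add: complex_eq_iff)
    then show ?thesis by (simp add: harm_im_def flip: complex_cnj_power)
  qed
  then have "?f (- u) = - ?f u" for u
    by (simp add: rsq_def)
  then have "integral {-1..1} (\<lambda>u. ?f (- u)) = - integral {-1..1} ?f" by simp
  moreover have "integral {-1..1} (\<lambda>u. ?f (- u)) = integral {-1..1} ?f"
    using Henstock_Kurzweil_Integration.integral_reflect_real[of 1 "-1" ?f] by simp
  ultimately show ?thesis by (simp add: chord_int_def)
qed

text \<open>Marr's formula in direction \<theta>. Rotation leaves the radial factor alone and mixes
  cosine and sine part; the sine part integrates to 0, and the cosine part carries the angular value
  at \<theta>.\<close>

lemma chord_int_disk_basis_rotate: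
  "chord_int n (\<lambda>z. disk_basis n l j \<epsilon> (rotate_plane \<theta> z)) \<psi>
    = angular j \<epsilon> \<theta> * poly (jacobi_on (real n) (real j) l) 1 * poly (laplace_poly n (2 * l + j)) (cos \<psi>)"
proof -
  let ?p = "jacobi_on (real n) (real j) l"
  let ?C = "\<lambda>z. poly ?p (2 * rsq z - 1) * harm_re j z" and ?S = "\<lambda>z. poly ?p (2 * rsq z - 1) * harm_im j z"
  define a where "a = angular j \<epsilon> \<theta>"
  define b where "b = (if \<epsilon> = 0 then - sin (real j * \<theta>) else cos (real j * \<theta>))"
  have "(\<lambda>z. disk_basis n l j \<epsilon> (rotate_plane \<theta> z)) = (\<lambda>z. a * ?C z + b * ?S z)"
    by (auto simp: disk_basis_def harm_rotate_plane a_def b_def angular_def algebra_simps)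
  moreover have "chord_int n (\<lambda>z. a * ?C z + b * ?S z) \<psi> = a * chord_int n ?C \<psi> + b * chord_int n ?S \<psi>"
    unfolding chord_int_scale[symmetric]
    by (intro chord_int_add continuous_on_mult continuous_on_const continuous_on_poly_rsq continuous_on_harm)
  ultimately show ?thesis
    by (simp add: chord_int_radial_harm_im chord_int_zonal a_def)
qed

text \<open>De Moivre's formula in polar form also holds at the origin, whatever the value of
  \<open>Arg 0\<close>.\<close>

lemma basis_poly_eq:
  "basis_poly (real n + 1/2) k l \<epsilon> z
    = h_const (real n + 1/2) l k * disk_basis n l (k - 2 * l) \<epsilon> z"
proof -
  obtain x y where z: "z = (x, y)" by (cases z)
  let ?w = "Complex x y" and ?j = "k - 2 * l"
  have "Complex x y ^ ?j = rcis (cmod ?w ^ ?j) (real ?j * Arg ?w)"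
    by (metis DeMoivre2 rcis_cmod_Arg)
  then have "harm_re ?j z = cmod ?w ^ ?j * cos (real ?j * Arg ?w)"
    "harm_im ?j z = cmod ?w ^ ?j * sin (real ?j * Arg ?w)"
    by (simp_all add: harm_re_def harm_im_def z del: of_nat_diff)
  moreover have "rsq z = (cmod ?w)\<^sup>2" by (simp add: rsq_def z complex_norm)
  ultimately show ?thesis
    by (simp add: basis_poly_def disk_basis_def angular_def Let_def z mult_ac del: of_nat_diff)
qed

lemma disk_basis_circle:
  "disk_basis n l j \<epsilon> (cos \<xi>, sin \<xi>) = poly (jacobi_on (real n) (real j) l) 1 * angular j \<epsilon> \<xi>"
proof -
  have "Complex (cos \<xi>) (sin \<xi>) = cis \<xi>" by (simp add: complex_eq_iff)
  then show ?thesis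
    by (simp add: disk_basis_def harm_re_def harm_im_def Complex.DeMoivre angular_def rsq_def)
qed

section \<open>The sums over the two families of nodes\<close>

lemma sum_psi_node:
  assumes "degree p + 2 * n + 2 \<le> 4 * m + 1"
  shows "(\<Sum>i\<le>2 * m. sin (psi_node m i) ^ (2 * n + 2) * poly p (cos (psi_node m i)))
    = (2 * real m + 1) / pi * gegen_int n p"
proof -
  let ?p = "p * [:1, 0, -1:] ^ (n + 1)"
  have "poly [:1, 0, -1:] (cos x) = (sin x)\<^sup>2" for x :: real
    using sin_squared_eq[of x] by (simp add: power2_eq_square)
  then have e: "poly ?p (cos x) = poly p (cos x) * sin x ^ (2 * n + 2)" for x :: real
    by (simp only: poly_mult poly_power flip: power_mult) (simp add: algebra_simps)
  have "degree ([:1, 0, -1::real:] ^ (n + 1)) = 2 * n + 2"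
    by (subst degree_power_eq) simp_all
  then have "degree ?p \<le> 4 * m + 1"
    using degree_mult_le[of p "[:1, 0, -1:] ^ (n + 1)"] assms by linarith
  from chebyshev_quadrature[OF this] show ?thesis
    unfolding e gegen_int_def by (simp add: field_simps)
qed

text \<open>The degree budget is tight: k = 2m - 2n - 1 and k' = 2m, together with 2n + 2 from the
  weight, give exactly 4m + 1. Of the sine factors, 2n + 1 stem from the Radon projection and one
  from \<open>T_fun\<close>.\<close>

lemma sum_psi_node_gegenbauer:
  assumes "k + 2 * n + 1 \<le> 2 * m" "k' \<le> 2 * m"
  shows "(\<Sum>i\<le>2 * m. sin (psi_node m i) ^ (2 * n + 2)
      * (poly (laplace_poly n k) (cos (psi_node m i)) * poly (gegenbauer (real n + 1) k') (cos (psi_node m i))))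
    = (if k' = k then (2 * real m + 1) / (real n + 1 + real k) else 0)"
proof -
  interpret positive_functional "gegen_int n" by (rule positive_functional_gegen_int)
  let ?c = "gegenbauer_1 n k' / ball_moment n 0"
  let ?p = "laplace_poly n k * gegenbauer (real n + 1) k'"
  have "degree ?p \<le> k + k'"
    unfolding gegenbauer_nat
    by (intro order.trans[OF degree_mult_le] add_mono order.trans[OF degree_smult_le])
       (simp_all add: degree_laplace_poly)
  then have "degree ?p + 2 * n + 2 \<le> 4 * m + 1" using assms by simp
  from sum_psi_node[OF this]
  have "(\<Sum>i\<le>2 * m. sin (psi_node m i) ^ (2 * n + 2)
      * (poly (laplace_poly n k) (cos (psi_node m i)) * poly (gegenbauer (real n + 1) k') (cos (psi_node m i))))
    = (2 * real m + 1) / pi * (?c * gegen_int n (laplace_poly n k * laplace_poly n k'))"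
    by (simp add: gegenbauer_nat smult mult_ac del: power_Suc)
  also have "\<dots> = (if k' = k then (2 * real m + 1) / (real n + 1 + real k) else 0)"
  proof (cases "k' = k")
    case True
    let ?N = "gegen_int n (laplace_poly n k * laplace_poly n k)"
    have pos: "real n + 1 + real k > 0" "ball_moment n 0 > 0" by (simp_all add: ball_moment_0_pos)
    have "pi * ball_moment n 0 = (real n + 1 + real k) * (gegenbauer_1 n k * ?N)"
      using laplace_poly_norm[of n k] by simp
    then have "gegenbauer_1 n k * ?N = pi * ball_moment n 0 / (real n + 1 + real k)"
      using pos by (simp add: field_simps)
    then have "?c * ?N = pi / (real n + 1 + real k)" using True pos by simp
    then show ?thesis using True by simp
  next
    case False
    then show ?thesis
      using orthogonal_seq_laplace_poly[of n] by (simp add: orthogonal_seq_def)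
  qed
  finally show ?thesis .
qed

text \<open>This determines \<lambda>: it inverts the product of the squared constant
  \<open>h_const\<close>, the two Jacobi values at 1 and the mean square \<open>d_const\<close> of
  the angular function over the nodes.\<close>

lemma lambda_const_normalization:
  fixes n l k :: nat
  defines "\<mu> \<equiv> real n + 1/2"
  assumes "2 * l \<le> k"
  shows "lambda_const \<mu> l k * (h_const \<mu> l k)\<^sup>2 * (poly (jacobi_on (real n) (real (k - 2 * l)) l) 1)\<^sup>2 * d_const l k = 1"
proof -
  define j where "j = k - 2 * l"
  have k: "k = 2 * l + j" "k - l = l + j" using assms(2) by (simp_all add: j_def)
  define d where "d = d_const l k"
  have d: "d > 0" by (simp add: d_def d_const_def)
  have G: "Gamma (real j + \<mu> + 3/2) = fact (j + n + 1)" "Gamma (\<mu> + 3/2) = fact (n + 1)"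
    "Gamma (real j + 1) = fact j"
    using Gamma_fact[of "j + n + 1", where 'a = real] Gamma_fact[of "n + 1", where 'a = real]
      Gamma_fact[of j, where 'a = real]
    by (simp_all add: \<mu>_def algebra_simps del: fact_Suc)
  have h: "(h_const \<mu> l k)\<^sup>2 = 1 / d * (fact (j + n + 1) / (fact (n + 1) * fact j))"
    unfolding h_const_def j_def[symmetric] G d_def[symmetric] using d by simp
  define Pl where "Pl = pochhammer (real (n + 1)) l"
  define Pk where "Pk = pochhammer (real (n + 2)) (l + j)"
  have pos: "Pl > 0" "Pk > 0" unfolding Pl_def Pk_def by (intro pochhammer_pos; simp)+
  have lam: "lambda_const \<mu> l k = fact l * fact (l + j) * real (l + j + n + 1) / (Pl * Pk * real (2 * l + j + n + 1))"
  proof -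
    have "\<mu> + 1/2 = real (n + 1)" "\<mu> + 3/2 = real (n + 2)" by (simp_all add: \<mu>_def)
    moreover have "real (k - l) + \<mu> + 1/2 = real (l + j + n + 1)" unfolding k(2) by (simp add: \<mu>_def)
    moreover have "real k + \<mu> + 1/2 = real (2 * l + j + n + 1)" unfolding k(1) by (simp add: \<mu>_def)
    ultimately show ?thesis unfolding lambda_const_def Pl_def Pk_def by (simp only: k(2))
  qed
  have p: "(poly (jacobi_on (real n) (real j) l) 1)\<^sup>2
      = fact j * Pl * fact (l + n + j) * real (2 * l + j + n + 1) / (fact (j + n + 1) * fact (l + j) * fact l)"
    unfolding poly_jacobi_on_1_square Pl_def by (simp only: add_ac)
  \<comment> \<open>Both sides are (l + j + n + 1)!. This is the one relation needed beyond
    cancelling equal factors.\<close>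
  have f: "real (l + j + n + 1) * fact (l + n + j) = fact (n + 1) * Pk"
    using fact_add_pochhammer[of "n + 1" "l + j"] fact_Suc[of "l + n + j", where 'a = real]
    by (simp add: Pk_def add_ac del: fact_Suc)
  have key: "(A * B * R / (Pl * Pk * Q)) * (1 / d * (E / (M * J))) * (J * Pl * F * Q / (E * B * A)) * d = 1"
    if "A > 0" "B > 0" "Q > 0" "E > 0" "M > 0" "J > 0" "R * F = M * Pk" for A B R Q E M J F :: real
  proof -
    have key: "(A * B * R / (Pl * Pk * Q)) * (1 / d * (E / (M * J))) * (J * Pl * F * Q / (E * B * A)) * d = R * F / (M * Pk)"
      using that(1-6) pos d by simp
    then show ?thesis using that pos by simp
  qed
  show ?thesis
    unfolding lam h p j_def[symmetric] d_def[symmetric]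
    by (rule key) (use f in \<open>simp_all del: fact_Suc\<close>)
qed

lemma finite_basis_index: "finite (basis_index k)"
  by (rule finite_subset[of _ "{..k} \<times> {..1}"]) (auto simp: basis_index_def)

lemma D_kernel_circle:
  "D_kernel (real n + 1/2) k \<xi> z = (\<Sum>(l, \<epsilon>)\<in>basis_index k.
     lambda_const (real n + 1/2) l k * (h_const (real n + 1/2) l k)\<^sup>2
       * poly (jacobi_on (real n) (real (k - 2 * l)) l) 1
       * angular (k - 2 * l) \<epsilon> \<xi> * disk_basis n l (k - 2 * l) \<epsilon> z)"
  unfolding D_kernel_def
  by (intro sum.cong) (auto simp: basis_poly_eq disk_basis_circle power2_eq_square)

text \<open>All frequencies k - 2l' have the parity of \<open>k\<close>, as the discrete
  orthogonality demands, so only the index (l, \<epsilon>) survives, with the mean square that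
  \<lambda> cancels.\<close>

lemma sum_phi_node_D_kernel:
  assumes l: "(l, \<epsilon>) \<in> basis_index k" and k: "k \<le> 2 * m"
  shows "poly (jacobi_on (real n) (real (k - 2 * l)) l) 1
      * (\<Sum>\<nu>\<le>2 * m. angular (k - 2 * l) \<epsilon> (phi_node m \<nu>) * D_kernel (real n + 1/2) k (phi_node m \<nu>) z)
    = (2 * real m + 1) * disk_basis n l (k - 2 * l) \<epsilon> z"
proof -
  define w where "w l' \<epsilon>' = lambda_const (real n + 1/2) l' k * (h_const (real n + 1/2) l' k)\<^sup>2
     * poly (jacobi_on (real n) (real (k - 2 * l')) l') 1 * disk_basis n l' (k - 2 * l') \<epsilon>' z" for l' \<epsilon>'
  have idx: "2 * l' \<le> k" "\<epsilon>' \<le> 1" "\<epsilon>' = 1 \<Longrightarrow> k - 2 * l' > 0" if "(l', \<epsilon>') \<in> basis_index k" for l' \<epsilon>'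
    using that by (auto simp: basis_index_def)
  have ang: "(\<Sum>\<nu>\<le>2 * m. angular (k - 2 * l) \<epsilon> (phi_node m \<nu>) * angular (k - 2 * l') \<epsilon>' (phi_node m \<nu>))
      = (if (l', \<epsilon>') = (l, \<epsilon>) then (2 * real m + 1) * d_const l k else 0)"
    if i: "(l', \<epsilon>') \<in> basis_index k" for l' \<epsilon>'
  proof -
    have "even (k - 2 * l + (k - 2 * l'))"
      using idx(1)[OF l] idx(1)[OF i] by simp
    moreover have "k - 2 * l = k - 2 * l' \<longleftrightarrow> l' = l" "k - 2 * l = 0 \<longleftrightarrow> \<not> 2 * l < k"
      using idx(1)[OF l] idx(1)[OF i] by auto
    ultimately show ?thesis
      using sum_angular_phi_node[of "k - 2 * l" m "k - 2 * l'" \<epsilon> \<epsilon>'] k idx[OF l] idx[OF i]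
      by (auto simp: d_const_def)
  qed
  have "(\<Sum>\<nu>\<le>2 * m. angular (k - 2 * l) \<epsilon> (phi_node m \<nu>) * D_kernel (real n + 1/2) k (phi_node m \<nu>) z)
      = (\<Sum>\<nu>\<le>2 * m. \<Sum>(l', \<epsilon>')\<in>basis_index k. w l' \<epsilon>' *
          (angular (k - 2 * l) \<epsilon> (phi_node m \<nu>) * angular (k - 2 * l') \<epsilon>' (phi_node m \<nu>)))"
    unfolding D_kernel_circle sum_distrib_left
    by (intro sum.cong) (auto simp: w_def mult_ac)
  also have "\<dots> = (\<Sum>(l', \<epsilon>')\<in>basis_index k. w l' \<epsilon>' * (\<Sum>\<nu>\<le>2 * m.
          angular (k - 2 * l) \<epsilon> (phi_node m \<nu>) * angular (k - 2 * l') \<epsilon>' (phi_node m \<nu>)))"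
    by (subst sum.swap) (auto simp: sum_distrib_left intro!: sum.cong)
  also have "\<dots> = (\<Sum>i\<in>basis_index k. if i = (l, \<epsilon>) then w l \<epsilon> * ((2 * real m + 1) * d_const l k) else 0)"
  proof (intro sum.cong refl)
    fix i assume "i \<in> basis_index k"
    then obtain l' \<epsilon>' where i: "i = (l', \<epsilon>')" "(l', \<epsilon>') \<in> basis_index k" by (cases i) auto
    show "(case i of (l', \<epsilon>') \<Rightarrow> w l' \<epsilon>' * (\<Sum>\<nu>\<le>2 * m.
          angular (k - 2 * l) \<epsilon> (phi_node m \<nu>) * angular (k - 2 * l') \<epsilon>' (phi_node m \<nu>)))
      = (if i = (l, \<epsilon>) then w l \<epsilon> * ((2 * real m + 1) * d_const l k) else 0)"
      unfolding i(1) prod.case ang[OF i(2)] by auto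
  qed
  also have "\<dots> = w l \<epsilon> * ((2 * real m + 1) * d_const l k)"
    using l finite_basis_index by simp
  finally have "poly (jacobi_on (real n) (real (k - 2 * l)) l) 1
      * (\<Sum>\<nu>\<le>2 * m. angular (k - 2 * l) \<epsilon> (phi_node m \<nu>) * D_kernel (real n + 1/2) k (phi_node m \<nu>) z)
    = (lambda_const (real n + 1/2) l k * (h_const (real n + 1/2) l k)\<^sup>2
        * (poly (jacobi_on (real n) (real (k - 2 * l)) l) 1)\<^sup>2 * d_const l k)
      * ((2 * real m + 1) * disk_basis n l (k - 2 * l) \<epsilon> z)"
    by (simp only: w_def power2_eq_square mult_ac)
  then show ?thesis
    using lambda_const_normalization[OF idx(1)[OF l]] by simp
qed

lemma psi_node_bounds:
  assumes "i \<le> 2 * m"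
  shows "0 < psi_node m i" "psi_node m i < pi"
proof -
  have "(2 * real i + 1) / (4 * real m + 2) < 1" using assms by (simp add: divide_less_eq)
  then have "(2 * real i + 1) / (4 * real m + 2) * pi < 1 * pi" by (rule mult_strict_right_mono) simp
  then show "psi_node m i < pi" by (simp add: psi_node_def)
  show "0 < psi_node m i" by (simp add: psi_node_def)
qed

text \<open>For each k' the double sum over the nodes factors. The \<psi>-sum vanishes unless k' =
  k, where (2m + 1)/(k + n + 1) cancels the weight k + \<mu> + 1/2 of the kernel; the \<phi>-sum
  supplies the other factor 2m + 1 against the denominator of \<open>T_fun\<close>.\<close>

lemma A_op_disk_basis:
  assumes l: "(l, \<epsilon>) \<in> basis_index k" and k: "k + 2 * n + 1 \<le> 2 * m"
  shows "A_op (real n + 1/2) m (disk_basis n l (k - 2 * l) \<epsilon>) z = disk_basis n l (k - 2 * l) \<epsilon> z"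
proof -
  let ?\<mu> = "real n + 1/2" and ?j = "k - 2 * l"
  define p1 where "p1 = poly (jacobi_on (real n) (real ?j) l) 1"
  define M where "M = 2 * real m + 1"
  have M: "M > 0" by (simp add: M_def)
  have kj: "2 * l + ?j = k" using l by (auto simp: basis_index_def)
  define ang where "ang \<nu> = angular ?j \<epsilon> (phi_node m \<nu>)" for \<nu>
  define q where "q i = poly (laplace_poly n k) (cos (psi_node m i))" for i
  define C where "C k' i = poly (gegenbauer (real n + 1) k') (cos (psi_node m i))" for k' i
  define D where "D k' \<nu> = D_kernel ?\<mu> k' (phi_node m \<nu>) z" for k' \<nu>
  have radon: "radon_proj ?\<mu> (phi_node m \<nu>) (disk_basis n l ?j \<epsilon>) (cos (psi_node m i))
      = sin (psi_node m i) ^ (2 * n + 1) * (ang \<nu> * p1 * q i)" if "i \<le> 2 * m" for \<nu> i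
    unfolding radon_proj_cos[OF continuous_on_disk_basis psi_node_bounds[OF that]]
      chord_int_disk_basis_rotate ang_def p1_def q_def kj ..
  have T: "T_fun ?\<mu> m i \<nu> z = sin (psi_node m i) / M\<^sup>2 * (\<Sum>k'\<le>2 * m. (real k' + real n + 1) * C k' i * D k' \<nu>)" for i \<nu>
  proof -
    have "?\<mu> + 1/2 = real n + 1" by simp
    then have "Phi_kernel ?\<mu> (2 * m) (phi_node m \<nu>) (cos (psi_node m i)) z
        = (\<Sum>k'\<le>2 * m. (real k' + real n + 1) * C k' i * D k' \<nu> / (real n + 1))"
      unfolding Phi_kernel_def C_def D_def by (intro sum.cong) (simp_all add: add_ac)
    also have "\<dots> = (\<Sum>k'\<le>2 * m. (real k' + real n + 1) * C k' i * D k' \<nu>) / (real n + 1)"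
      by (simp add: sum_divide_distrib)
    finally show ?thesis unfolding T_fun_def M_def by (simp add: add_ac)
  qed
  have "A_op ?\<mu> m (disk_basis n l ?j \<epsilon>) z = (\<Sum>\<nu>\<le>2 * m. \<Sum>i\<le>2 * m. \<Sum>k'\<le>2 * m.
      p1 / M\<^sup>2 * (real k' + real n + 1) * (ang \<nu> * D k' \<nu>) * (sin (psi_node m i) ^ (2 * n + 2) * (q i * C k' i)))"
    unfolding A_op_def
  proof (intro sum.cong refl)
    fix \<nu> i assume "i \<in> {..2 * m}"
    then have i: "i \<le> 2 * m" by simp
    show "radon_proj ?\<mu> (phi_node m \<nu>) (disk_basis n l ?j \<epsilon>) (cos (psi_node m i)) * T_fun ?\<mu> m i \<nu> z
      = (\<Sum>k'\<le>2 * m. p1 / M\<^sup>2 * (real k' + real n + 1) * (ang \<nu> * D k' \<nu>)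
          * (sin (psi_node m i) ^ (2 * n + 2) * (q i * C k' i)))"
      unfolding T sum_distrib_left radon[OF i] by (intro sum.cong) (simp_all add: mult_ac)
  qed
  also have "\<dots> = (\<Sum>k'\<le>2 * m. \<Sum>\<nu>\<le>2 * m. \<Sum>i\<le>2 * m.
      p1 / M\<^sup>2 * (real k' + real n + 1) * (ang \<nu> * D k' \<nu>) * (sin (psi_node m i) ^ (2 * n + 2) * (q i * C k' i)))"
    by (subst sum.swap[of _ "{..2 * m}" "{..2 * m}"], subst (2) sum.swap) (rule refl)
  also have "\<dots> = (\<Sum>k'\<le>2 * m. p1 / M\<^sup>2 * (real k' + real n + 1) * (\<Sum>\<nu>\<le>2 * m. ang \<nu> * D k' \<nu>)
      * (\<Sum>i\<le>2 * m. sin (psi_node m i) ^ (2 * n + 2) * (q i * C k' i)))"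
    by (simp only: mult.assoc[of _ "sum _ _" "sum _ _"] sum_product)
       (simp only: sum_distrib_left mult.assoc)
  also have "\<dots> = (\<Sum>k'\<le>2 * m. if k' = k then p1 / M\<^sup>2 * (real k' + real n + 1) * (\<Sum>\<nu>\<le>2 * m. ang \<nu> * D k' \<nu>)
      * (M / (real n + 1 + real k)) else 0)"
    by (intro sum.cong refl)
       (use sum_psi_node_gegenbauer[OF k] in \<open>simp add: q_def C_def M_def del: power_Suc\<close>)
  also have "\<dots> = p1 / M\<^sup>2 * (real k + real n + 1) * (\<Sum>\<nu>\<le>2 * m. ang \<nu> * D k \<nu>) * (M / (real n + 1 + real k))"
    using k by simp
  also have "\<dots> = p1 * (\<Sum>\<nu>\<le>2 * m. ang \<nu> * D k \<nu>) / M"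
  proof -
    have "p1 / M\<^sup>2 * N * s * (M / N) = p1 * s / M" if "N > 0" for N s :: real
      using that M by (simp add: power2_eq_square)
    from this[of "real n + 1 + real k"] show ?thesis by (simp add: add_ac)
  qed
  also have "p1 * (\<Sum>\<nu>\<le>2 * m. ang \<nu> * D k \<nu>) = M * disk_basis n l ?j \<epsilon> z"
    using sum_phi_node_D_kernel[OF l, of m n z] k unfolding p1_def ang_def D_def M_def by simp
  finally show ?thesis using M by simp
qed

text \<open>Continuity is carried along because additivity of the Radon projection needs
  integrability on the chords.\<close>

definition reproduced :: "nat \<Rightarrow> nat \<Rightarrow> (real \<times> real \<Rightarrow> real) \<Rightarrow> bool" where
  "reproduced n m F \<longleftrightarrow> continuous_on UNIV F \<and> A_op (real n + 1/2) m F = F"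

lemma reproduced_add:
  assumes "reproduced n m F" "reproduced n m G"
  shows "reproduced n m (\<lambda>z. F z + G z)"
proof -
  have c: "continuous_on UNIV F" "continuous_on UNIV G" using assms by (auto simp: reproduced_def)
  have "radon_proj (real n + 1/2) (phi_node m \<nu>) (\<lambda>z. F z + G z) (cos (psi_node m i))
      = radon_proj (real n + 1/2) (phi_node m \<nu>) F (cos (psi_node m i))
        + radon_proj (real n + 1/2) (phi_node m \<nu>) G (cos (psi_node m i))" if "i \<le> 2 * m" for i \<nu>
    using that c
    by (simp add: radon_proj_cos psi_node_bounds continuous_on_add chord_int_add continuous_on_rotate_plane
        distrib_left del: power_Suc)
  then have "A_op (real n + 1/2) m (\<lambda>z. F z + G z) z = A_op (real n + 1/2) m F z + A_op (real n + 1/2) m G z" for z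
    unfolding A_op_def sum.distrib[symmetric] by (intro sum.cong) (simp_all add: distrib_right)
  then show ?thesis using assms c by (auto simp: reproduced_def intro!: continuous_intros)
qed

lemma reproduced_scale:
  assumes "reproduced n m F"
  shows "reproduced n m (\<lambda>z. c * F z)"
proof -
  have "radon_proj \<mu> \<theta> (\<lambda>z. c * F z) t = c * radon_proj \<mu> \<theta> F t" for \<mu> \<theta> t
    unfolding radon_proj_def by (simp add: mult.assoc)
  then have "A_op \<mu> m (\<lambda>z. c * F z) z = c * A_op \<mu> m F z" for \<mu> z
    unfolding A_op_def by (simp add: sum_distrib_left mult.assoc)
  then show ?thesis using assms by (auto simp: reproduced_def intro!: continuous_intros)
qed

lemma reproduced_zero: "reproduced n m (\<lambda>_. 0)"
  by (auto simp: reproduced_def A_op_def radon_proj_def)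

text \<open>In t = 2 r^2 - 1 the factor rsq^a is ((1 + t)/2)^a and expands into Jacobi polynomials
  of degree l \<le> a with second parameter \<open>j\<close>. Each yields a basis function of degree
  2l + j, within the assumed bound.\<close>

lemma reproduced_rsq_harm:
  assumes "2 * a + j + 2 * n + 1 \<le> 2 * m"
  shows "reproduced n m (\<lambda>z. rsq z ^ a * harm_re j z)" "reproduced n m (\<lambda>z. rsq z ^ a * harm_im j z)"
proof -
  have main: "reproduced n m (\<lambda>z. rsq z ^ a * (if \<epsilon> = 0 then harm_re j z else harm_im j z))"
    if \<epsilon>: "\<epsilon> \<le> 1" "\<epsilon> = 1 \<Longrightarrow> j > 0" for \<epsilon> :: nat
  proof -
    let ?h = "\<lambda>z. if \<epsilon> = 0 then harm_re j z else harm_im j z"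
    have deg: "\<And>l. degree (jacobi_on (real n) (real j) l) = l" by (rule degree_jacobi_on)
    have nz: "\<And>l. jacobi_on (real n) (real j) l \<noteq> 0" by (rule jacobi_on_nonzero)
    have "degree ([:1/2, 1/2::real:] ^ a) \<le> a" by (simp add: degree_power_eq)
    from deg nz this have "reproduced n m (\<lambda>z. poly ([:1/2, 1/2:] ^ a) (2 * rsq z - 1) * ?h z)"
    proof (induction rule: poly_basis_induct)
      case zero
      then show ?case using reproduced_zero by simp
    next
      case (add p q)
      then show ?case using reproduced_add[OF add] by (simp add: distrib_right)
    next
      case (smult c p)
      then show ?case using reproduced_scale[OF smult, of c] by (simp add: mult.assoc)
    next
      case (basis l)
      have "(l, \<epsilon>) \<in> basis_index (2 * l + j)"
        using \<epsilon> by (auto simp: basis_index_def le_Suc_eq)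
      then have "A_op (real n + 1/2) m (disk_basis n l j \<epsilon>) z = disk_basis n l j \<epsilon> z" for z
        using A_op_disk_basis[of l \<epsilon> "2 * l + j" n m z] basis assms by simp
      then have "reproduced n m (disk_basis n l j \<epsilon>)"
        by (auto simp: reproduced_def continuous_on_disk_basis)
      then show ?case by (simp only: disk_basis_def[abs_def])
    qed
    moreover have "poly ([:1/2, 1/2:] ^ a) (2 * rsq z - 1) = rsq z ^ a" for z
      by (simp add: poly_power field_simps)
    ultimately show ?thesis by simp
  qed
  show "reproduced n m (\<lambda>z. rsq z ^ a * harm_re j z)" using main[of 0] by simp
  show "reproduced n m (\<lambda>z. rsq z ^ a * harm_im j z)"
    \<comment> \<open>The sine function of frequency 0 has no admissible index, but it is
      zero.\<close>
    using main[of 1] reproduced_zero by (cases "j = 0") simp_all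
qed

text \<open>The decomposition of homogeneous polynomials of degree d into harmonics times powers of
  r^2, generated inductively so that reproduction passes from these products to monomials.\<close>

inductive_set harm_span :: "nat \<Rightarrow> (real \<times> real \<Rightarrow> real) set" for d where
  re: "2 * a + j = d \<Longrightarrow> (\<lambda>z. rsq z ^ a * harm_re j z) \<in> harm_span d"
| im: "2 * a + j = d \<Longrightarrow> (\<lambda>z. rsq z ^ a * harm_im j z) \<in> harm_span d"
| add: "F \<in> harm_span d \<Longrightarrow> G \<in> harm_span d \<Longrightarrow> (\<lambda>z. F z + G z) \<in> harm_span d"
| scale: "F \<in> harm_span d \<Longrightarrow> (\<lambda>z. c * F z) \<in> harm_span d"

lemma harm_span_lincomb:
  assumes "F \<in> harm_span d" "G \<in> harm_span d" "\<And>z. H z = a * F z + b * G z"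
  shows "H \<in> harm_span d"
proof -
  have "H = (\<lambda>z. a * F z + b * G z)" using assms(3) by auto
  then show ?thesis using assms(1,2) by (auto intro: harm_span.add harm_span.scale)
qed

text \<open>By \<open>mult_harm_Suc\<close>: a downward move of the frequency is balanced by one
  more factor \<open>rsq\<close>, so the degree grows by one either way.\<close>

lemma harm_span_mult_coordinate:
  assumes "F \<in> harm_span d"
  shows "(\<lambda>z. fst z * F z) \<in> harm_span (Suc d)" "(\<lambda>z. snd z * F z) \<in> harm_span (Suc d)"
proof -
  have "(\<lambda>z. fst z * F z) \<in> harm_span (Suc d) \<and> (\<lambda>z. snd z * F z) \<in> harm_span (Suc d)"
    using assms
  proof induction
    case (re a j)
    show ?case
    proof (cases j)
      case 0
      have "(\<lambda>z. rsq z ^ a * harm_re 1 z) \<in> harm_span (Suc d)" "(\<lambda>z. rsq z ^ a * harm_im 1 z) \<in> harm_span (Suc d)"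
        using re 0 by (auto intro: harm_span.intros)
      then show ?thesis using 0 by (simp add: harm_Suc mult_ac)
    next
      case (Suc i)
      have up: "(\<lambda>z. rsq z ^ a * harm_re (Suc j) z) \<in> harm_span (Suc d)"
        "(\<lambda>z. rsq z ^ a * harm_im (Suc j) z) \<in> harm_span (Suc d)"
        and down: "(\<lambda>z. rsq z ^ Suc a * harm_re i z) \<in> harm_span (Suc d)"
        "(\<lambda>z. rsq z ^ Suc a * harm_im i z) \<in> harm_span (Suc d)"
        using re Suc by (intro harm_span.intros; simp)+
      have x: "fst z * (rsq z ^ a * harm_re j z)
          = 1/2 * (rsq z ^ a * harm_re (Suc j) z) + 1/2 * (rsq z ^ Suc a * harm_re i z)" for z
        unfolding Suc mult.left_commute[of "fst z"] mult_harm_Suc by (simp add: algebra_simps add_divide_distrib diff_divide_distrib)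
      have y: "snd z * (rsq z ^ a * harm_re j z)
          = 1/2 * (rsq z ^ a * harm_im (Suc j) z) + (-1/2) * (rsq z ^ Suc a * harm_im i z)" for z
        unfolding Suc mult.left_commute[of "snd z"] mult_harm_Suc by (simp add: algebra_simps add_divide_distrib diff_divide_distrib)
      show ?thesis
        using harm_span_lincomb[OF up(1) down(1) x] harm_span_lincomb[OF up(2) down(2) y] by blast
    qed
  next
    case (im a j)
    show ?case
    proof (cases j)
      case 0
      \<comment> \<open>\<open>harm_im 0\<close> is zero; the zero function is in the span as 0
        times a generator.\<close>
      have "(\<lambda>z. 0 * (rsq z ^ a * harm_re 1 z)) \<in> harm_span (Suc d)"
        using im 0 by (intro harm_span.intros) simp
      then show ?thesis using 0 by simp
    next
      case (Suc i)
      have up: "(\<lambda>z. rsq z ^ a * harm_re (Suc j) z) \<in> harm_span (Suc d)"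
        "(\<lambda>z. rsq z ^ a * harm_im (Suc j) z) \<in> harm_span (Suc d)"
        and down: "(\<lambda>z. rsq z ^ Suc a * harm_re i z) \<in> harm_span (Suc d)"
        "(\<lambda>z. rsq z ^ Suc a * harm_im i z) \<in> harm_span (Suc d)"
        using im Suc by (intro harm_span.intros; simp)+
      have x: "fst z * (rsq z ^ a * harm_im j z)
          = 1/2 * (rsq z ^ a * harm_im (Suc j) z) + 1/2 * (rsq z ^ Suc a * harm_im i z)" for z
        unfolding Suc mult.left_commute[of "fst z"] mult_harm_Suc by (simp add: algebra_simps add_divide_distrib diff_divide_distrib)
      have y: "snd z * (rsq z ^ a * harm_im j z)
          = (-1/2) * (rsq z ^ a * harm_re (Suc j) z) + 1/2 * (rsq z ^ Suc a * harm_re i z)" for z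
        unfolding Suc mult.left_commute[of "snd z"] mult_harm_Suc by (simp add: algebra_simps add_divide_distrib diff_divide_distrib)
      show ?thesis
        using harm_span_lincomb[OF up(2) down(2) x] harm_span_lincomb[OF up(1) down(1) y] by blast
    qed
  next
    case (add F G)
    then show ?case using harm_span.add[of _ "Suc d"] by (simp add: distrib_left)
  next
    case (scale F c)
    then have "(\<lambda>z. c * (fst z * F z)) \<in> harm_span (Suc d)" "(\<lambda>z. c * (snd z * F z)) \<in> harm_span (Suc d)"
      by (auto intro: harm_span.scale)
    then show ?case by (simp add: mult.left_commute)
  qed
  then show "(\<lambda>z. fst z * F z) \<in> harm_span (Suc d)" "(\<lambda>z. snd z * F z) \<in> harm_span (Suc d)" by auto
qed

lemma monomial_harm_span: "(\<lambda>z. fst z ^ i * snd z ^ j) \<in> harm_span (i + j)"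
proof (induction i)
  case 0
  show ?case
  proof (induction j)
    case 0
    have "(\<lambda>z. rsq z ^ 0 * harm_re 0 z) \<in> harm_span 0" by (rule harm_span.re) simp
    then show ?case by simp
  next
    case (Suc j)
    then show ?case using harm_span_mult_coordinate(2)[OF Suc] by simp
  qed
next
  case (Suc i)
  then show ?case using harm_span_mult_coordinate(1)[OF Suc] by (simp add: mult.assoc)
qed

lemma reproduced_monomial:
  assumes "i + j + 2 * n + 1 \<le> 2 * m"
  shows "reproduced n m (\<lambda>z. fst z ^ i * snd z ^ j)"
  using monomial_harm_span[of i j]
proof induction
  case (re a j)
  then show ?case using assms by (intro reproduced_rsq_harm) simp
next
  case (im a j)
  then show ?case using assms by (intro reproduced_rsq_harm) simp
qed (auto intro: reproduced_add reproduced_scale)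

lemma reproduced_sum:
  assumes "finite A" "\<And>a. a \<in> A \<Longrightarrow> reproduced n m (F a)"
  shows "reproduced n m (\<lambda>z. \<Sum>a\<in>A. F a z)"
  using assms by (induction A) (auto intro: reproduced_zero reproduced_add)

theorem theorem2p16:
  fixes \<mu> :: real and m :: nat and P :: "real \<times> real \<Rightarrow> real"
  assumes "\<mu> \<ge> 0"
    and "\<mu> + 1/2 \<in> \<nat>"
    and "P \<in> polys2 (2 * real m - 2 * \<mu>)"
  shows "A_op \<mu> m P = P"
proof -
  obtain N where N: "\<mu> + 1/2 = real N" using assms(2) by (auto elim: Nats_cases)
  \<comment> \<open>From \<mu> \<ge> 0 the natural number \<mu> + 1/2 is at least 1.\<close>
  then obtain n where n: "N = Suc n" using assms(1) by (cases N) auto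
  have \<mu>: "\<mu> = real n + 1/2" using N n by simp
  let ?S = "{(i, j). real (i + j) \<le> 2 * real m - 2 * \<mu>}"
  \<comment> \<open>The bound 2m - 2\<mu> equals 2m - 2n - 1; stated additively it stays correct
    when that number is negative and the index set is empty.\<close>
  have S: "i + j + 2 * n + 1 \<le> 2 * m" if "(i, j) \<in> ?S" for i j
  proof -
    have "real (i + j + 2 * n + 1) \<le> real (2 * m)" using that \<mu> by simp
    then show ?thesis by (simp only: of_nat_le_iff)
  qed
  have fin: "finite ?S"
    by (rule finite_subset[of _ "{..2 * m} \<times> {..2 * m}"]) (use S in fastforce)+
  obtain c where "\<And>x y. P (x, y) = (\<Sum>(i, j)\<in>?S. c i j * x ^ i * y ^ j)"
    using assms(3) unfolding polys2_def by blast
  then have P: "P = (\<lambda>z. \<Sum>a\<in>?S. c (fst a) (snd a) * (fst z ^ fst a * snd z ^ snd a))"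
    by (auto simp: split_beta mult.assoc)
  have "reproduced n m P"
    unfolding P
  proof (rule reproduced_sum[OF fin])
    fix a assume "a \<in> ?S"
    then have "fst a + snd a + 2 * n + 1 \<le> 2 * m" using S[of "fst a" "snd a"] by auto
    then show "reproduced n m (\<lambda>z. c (fst a) (snd a) * (fst z ^ fst a * snd z ^ snd a))"
      by (intro reproduced_scale reproduced_monomial)
  qed
  then show ?thesis by (simp add: reproduced_def \<mu>)
qed

end
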